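(* Suppose that, as $m\to\infty$, $f_1/m\to\bar f_1>0$, $m^{-1}\mathbb E\mathsf M\to\bar\kappa_1\ge 0$ and $m^{-1}\mathbb E\mathsf S\to\bar s\ge 0$ (with $f_j/m\to\bar f_j\geq 0$ for each class $j=2,\dots,K$). Then there is a number $\psi$ such that either $\psi=0$ when $\bar\kappa_1+\bar s=0$, or otherwise $\psi\in\bigl(0,(\bar\kappa_1+\bar s)\wedge 1\bigr)$ satisfies $$\log\frac{1-\psi}{\bar f_1+1-\psi}=\ell_{\mathsf M+\mathsf S}'(\psi),$$ or equivalently $$\psi+\Lambda_{\mathsf M+\mathsf S}'\Bigl(-\log\frac{1-\psi}{\bar f_1+1-\psi}\Bigr)=0,$$ and such that, as $m\to\infty$, for every filament $i$, $$\mathbb P[L_i\ge l]\to\Bigl(\rho_i\,\frac{1-\psi}{\bar f_1+1-\psi}\Bigr)^l,\qquad l=0,1,2,\dots,$$ and $$m^{-1}M\to\bar\kappa_1\,\frac{1-\psi}{\bar f_1+1-\psi}\quad\text{in probability}.$$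
   Context: Model. For each $m\in\mathbb N$ consider $m$ monomers and $f=f(m)\ge1$ filaments with dissociation constants $0<\kappa_1\le\kappa_2\le\dots\le\kappa_f$ (which may depend on $m$). There is a fixed number $K$ of filament classes: $\kappa_i\in\{\varkappa_1,\dots,\varkappa_K\}$ with $\varkappa_1<\dots<\varkappa_K$, and $f_j\ge1$ is the number of filaments $n$ with $\kappa_n=\varkappa_j$, so $f=\sum_{j=1}^K f_j$, $\kappa_1=\varkappa_1$, and $f_1$ is the number of filaments with the smallest dissociation constant. Set $\rho_i=\kappa_1/\kappa_i$ for a filament $i$ and $\varrho_j=\varkappa_1/\varkappa_j$ for a class $j$. The $\varkappa_j$ may vary with $m$, but the ratios $\varrho_1=1>\varrho_2>\dots>\varrho_K>0$ are fixed. Statements about "filament $i$" as $m\to\infty$ refer to an index $i=i(m)\le f(m)$ that belongs to the same class for all $m$, so that $\rho_i$ is constant. Stationary distribution. $(L_1,\dots,L_f)$ is a random vector of nonnegative integers with $$\mathbb P[L_1=l_1,\dots,L_f=l_f]=c_{m,f}^{-1}\,m!\,\frac{\kappa_1^{-l_1}\cdots\kappa_f^{-l_f}}{(m-l_1-\dots-l_f)!},\qquad l_1+\dots+l_f\le m,$$ where $c_{m,f}$ is the normalization constant, and $M=m-L_1-\dots-L_f$. Auxiliary variables. $\mathsf M$ is Poisson with mean $\kappa_1$; for $i>f_1$, $\mathsf L_i$ is geometric with $\mathbb P[\mathsf L_i\ge l]=\rho_i^l$, $l=0,1,\dots$; all are independent. $\mathsf S=\sum_{i>f_1}\mathsf L_i$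 ($\mathsf S\equiv0$ if $f_1=f$). All depend on $m$, which is suppressed. Rate function. With $\bar f_j=\lim f_j/m$, define for $\theta\ge0$ $$\Lambda_{\mathsf M+\mathsf S}(\theta)=\lim_{m\to\infty}\tfrac1m\log\mathbb E e^{-\theta(\mathsf M+\mathsf S)}=-\bar\kappa_1(1-e^{-\theta})+\sum_{j=2}^K\bar f_j\log\frac{1-\varrho_j}{1-\varrho_je^{-\theta}},$$ $$\ell_{\mathsf M+\mathsf S}(x)=\sup_{\theta\ge0}\{-\theta x-\Lambda_{\mathsf M+\mathsf S}(\theta)\},\qquad x\ge0.$$ $a\wedge b$ denotes the minimum. *)

theory Defs
  imports "HOL-Probability.Probability"
begin

section \<open>Filaments and their stationary distribution\<close>

text \<open>Filaments are numbered \<open>1..f\<close> and \<open>\<kappa> i\<close> is the dissociation constant of filament \<open>i\<close>.\<close>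

definition class_size :: "(nat \<Rightarrow> real) \<Rightarrow> nat \<Rightarrow> real \<Rightarrow> nat" where
  "class_size \<kappa> f x = card {n \<in> {1..f}. \<kappa> n = x}"

text \<open>
  A state \<open>(l\<^sub>1, \<dots>, l\<^sub>f)\<close> is a function on \<open>nat\<close> that vanishes off \<open>{1..f}\<close>, in line with the
  default value used for \<open>Pi_pmf\<close> below.
\<close>

definition filament_states :: "nat \<Rightarrow> nat \<Rightarrow> (nat \<Rightarrow> nat) set" where
  "filament_states m f = {l. (\<forall>i. i \<notin> {1..f} \<longrightarrow> l i = 0) \<and> (\<Sum>i=1..f. l i) \<le> m}"

definition filament_weight :: "(nat \<Rightarrow> real) \<Rightarrow> nat \<Rightarrow> nat \<Rightarrow> (nat \<Rightarrow> nat) \<Rightarrow> real" where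
  "filament_weight \<kappa> m f l =
     fact m * (\<Prod>i=1..f. inverse (\<kappa> i) ^ l i) / fact (m - (\<Sum>i=1..f. l i))"

definition normalization_const :: "(nat \<Rightarrow> real) \<Rightarrow> nat \<Rightarrow> nat \<Rightarrow> real" where
  "normalization_const \<kappa> m f = (\<Sum>l\<in>filament_states m f. filament_weight \<kappa> m f l)"

definition stationary_pmf :: "(nat \<Rightarrow> real) \<Rightarrow> nat \<Rightarrow> nat \<Rightarrow> (nat \<Rightarrow> nat) pmf" where
  "stationary_pmf \<kappa> m f = embed_pmf (\<lambda>l.
     if l \<in> filament_states m f then filament_weight \<kappa> m f l / normalization_const \<kappa> m f else 0)"

definition free_monomers :: "nat \<Rightarrow> nat \<Rightarrow> (nat \<Rightarrow> nat) \<Rightarrow> real" where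
  "free_monomers m f l = real m - (\<Sum>i=1..f. real (l i))"

text \<open>For positive dissociation constants the argument of \<open>embed_pmf\<close> is a probability mass function.\<close>

lemma finite_filament_states: "finite (filament_states m f)"
proof (rule finite_subset)
  show "filament_states m f \<subseteq>
    {l. \<forall>x. (x \<in> {1..f} \<longrightarrow> l x \<in> {..m}) \<and> (x \<notin> {1..f} \<longrightarrow> l x = 0)}"
  proof clarify
    fix l x assume l: "l \<in> filament_states m f"
    have "l x \<le> m" if "x \<in> {1..f}"
    proof -
      have "l x \<le> (\<Sum>i=1..f. l i)" using that by (intro member_le_sum) auto
      then show ?thesis using l by (simp add: filament_states_def)
    qed
    then show "(x \<in> {1..f} \<longrightarrow> l x \<in> {..m}) \<and> (x \<notin> {1..f} \<longrightarrow> l x = 0)"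
      using l by (auto simp: filament_states_def)
  qed
  show "finite {l. \<forall>x. (x \<in> {1..f} \<longrightarrow> l x \<in> {..m}) \<and> (x \<notin> {1..f} \<longrightarrow> l x = (0::nat))}"
    by (intro finite_set_of_finite_funs) auto
qed

lemma pmf_stationary:
  assumes "\<And>i. i \<in> {1..f} \<Longrightarrow> 0 < \<kappa> i"
  shows "pmf (stationary_pmf \<kappa> m f) l =
    (if l \<in> filament_states m f then filament_weight \<kappa> m f l / normalization_const \<kappa> m f else 0)"
proof -
  let ?S = "filament_states m f"
  have pos: "0 < filament_weight \<kappa> m f l" for l
    unfolding filament_weight_def by (intro divide_pos_pos mult_pos_pos prod_pos) (auto simp: assms)
  have "(\<lambda>_. 0) \<in> ?S" by (simp add: filament_states_def)
  then have Z: "0 < normalization_const \<kappa> m f"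
    unfolding normalization_const_def
    by (intro sum_pos) (auto simp: pos finite_filament_states)
  have "(\<integral>\<^sup>+l. ennreal (if l \<in> ?S then filament_weight \<kappa> m f l / normalization_const \<kappa> m f else 0)
          \<partial>count_space UNIV) =
        (\<Sum>l\<in>?S. ennreal (filament_weight \<kappa> m f l / normalization_const \<kappa> m f))"
    by (subst nn_integral_count_space'[OF finite_filament_states[of m f]]) auto
  also have "\<dots> = ennreal (\<Sum>l\<in>?S. filament_weight \<kappa> m f l / normalization_const \<kappa> m f)"
    using Z by (intro sum_ennreal) (auto intro!: divide_nonneg_pos less_imp_le[OF pos])
  also have "(\<Sum>l\<in>?S. filament_weight \<kappa> m f l / normalization_const \<kappa> m f) = 1"
    using Z by (simp flip: sum_divide_distrib add: normalization_const_def)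
  finally show ?thesis
    unfolding stationary_pmf_def using Z pos
    by (subst pmf_embed_pmf) (auto intro!: divide_nonneg_pos less_imp_le[OF pos])
qed


section \<open>Auxiliary variables and rate function\<close>

text \<open>
  \<open>aux_pmf\<close> is the joint law of the Poisson variable and of the geometric variables attached to the
  filaments above the smallest dissociation constant; as \<open>\<kappa>\<close> is sorted, these are
  \<open>f\<^sub>1 + 1, \<dots>, f\<close>. Recall that \<open>geometric_pmf p\<close> lives on \<open>{0, 1, \<dots>}\<close> and has tails
  \<open>(1 - p) ^ l\<close>.
\<close>

definition aux_pmf :: "(nat \<Rightarrow> real) \<Rightarrow> nat \<Rightarrow> (nat \<times> (nat \<Rightarrow> nat)) pmf" where
  "aux_pmf \<kappa> f = pair_pmf (poisson_pmf (\<kappa> 1))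
     (Pi_pmf {class_size \<kappa> f (\<kappa> 1)<..f} 0 (\<lambda>i. geometric_pmf (1 - \<kappa> 1 / \<kappa> i)))"

definition aux_M :: "nat \<times> (nat \<Rightarrow> nat) \<Rightarrow> real" where
  "aux_M \<omega> = real (fst \<omega>)"

definition aux_S :: "(nat \<Rightarrow> real) \<Rightarrow> nat \<Rightarrow> nat \<times> (nat \<Rightarrow> nat) \<Rightarrow> real" where
  "aux_S \<kappa> f \<omega> = (\<Sum>i\<in>{class_size \<kappa> f (\<kappa> 1)<..f}. real (snd \<omega> i))"

text \<open>Below, \<open>f\<close> and \<open>\<kappa>\<close> also depend on the number \<open>m\<close> of monomers.\<close>

definition aux_Lambda :: "(nat \<Rightarrow> nat) \<Rightarrow> (nat \<Rightarrow> nat \<Rightarrow> real) \<Rightarrow> real \<Rightarrow> real" where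
  "aux_Lambda f \<kappa> \<theta> = lim (\<lambda>m. 1 / real m * ln (measure_pmf.expectation (aux_pmf (\<kappa> m) (f m))
     (\<lambda>\<omega>. exp (- \<theta> * (aux_M \<omega> + aux_S (\<kappa> m) (f m) \<omega>)))))"

text \<open>
  For \<open>x \<ge> 0\<close> the supremum is over a set that is bounded above, so that it can be taken in the reals:
  \<open>-\<Lambda>\<close> is bounded by \<open>\<kappa>bar + (\<Sum>j=2..K. fbar j * ln (1 / (1 - \<rho> j)))\<close>, see \<open>aux_Lambda_eq\<close> below.
\<close>

definition aux_rate :: "(nat \<Rightarrow> nat) \<Rightarrow> (nat \<Rightarrow> nat \<Rightarrow> real) \<Rightarrow> real \<Rightarrow> real" where
  "aux_rate f \<kappa> x = (SUP \<theta>\<in>{0..}. - \<theta> * x - aux_Lambda f \<kappa> \<theta>)"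



lemma nat_pmf_expectation:
  fixes g :: "nat \<Rightarrow> real"
  assumes "\<And>n. 0 \<le> g n" and "(\<lambda>n. pmf p n * g n) sums s"
  shows "integrable (measure_pmf p) g" and "measure_pmf.expectation p g = s"
proof -
  have i: "integrable (count_space UNIV) (\<lambda>n. pmf p n * g n)"
    using assms by (auto simp: integrable_count_space_nat_iff abs_mult sums_iff)
  then show "integrable (measure_pmf p) g"
    by (simp add: measure_pmf_eq_density integrable_density)
  have "measure_pmf.expectation p g = integral\<^sup>L (count_space UNIV) (\<lambda>n. pmf p n * g n)"
    by (simp add: measure_pmf_eq_density integral_density)
  also have "\<dots> = s"
    using sums_integral_count_space_nat[OF i] assms(2) by (simp add: sums_iff)
  finally show "measure_pmf.expectation p g = s" .
qed

lemma poisson_laplace: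
  fixes r \<theta> :: real
  assumes "0 < r"
  shows "measure_pmf.expectation (poisson_pmf r) (\<lambda>n. exp (- \<theta> * real n))
    = exp (- r * (1 - exp (- \<theta>)))"
proof (rule nat_pmf_expectation)
  have "(\<lambda>n. exp (- r) * ((r * exp (- \<theta>)) ^ n /\<^sub>R fact n)) sums (exp (- r) * exp (r * exp (- \<theta>)))"
    by (intro sums_mult exp_converges)
  then show "(\<lambda>n. pmf (poisson_pmf r) n * exp (- \<theta> * real n)) sums exp (- r * (1 - exp (- \<theta>)))"
    using assms
    by (simp add: field_simps power_mult_distrib flip: exp_of_nat_mult exp_add)
qed simp

lemma poisson_mean:
  fixes r :: real
  assumes "0 < r"
  shows "measure_pmf.expectation (poisson_pmf r) real = r"
proof (rule nat_pmf_expectation)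
  have "(\<lambda>n. r * exp (- r) * (r ^ n /\<^sub>R fact n)) sums (r * exp (- r) * exp r)"
    by (intro sums_mult exp_converges)
  moreover have "r * exp (- r) * (r ^ n /\<^sub>R fact n) = pmf (poisson_pmf r) (Suc n) * real (Suc n)" for n
    using assms by (simp add: field_simps del: of_nat_Suc)
  ultimately have "(\<lambda>n. pmf (poisson_pmf r) (Suc n) * real (Suc n)) sums r"
    by (simp flip: exp_add add: mult.assoc)
  then show "(\<lambda>n. pmf (poisson_pmf r) n * real n) sums r"
    by (subst (asm) sums_Suc_iff) simp
qed simp

lemma geometric_laplace:
  fixes r \<theta> :: real
  assumes "0 < r" "r < 1" "0 \<le> \<theta>"
  shows "integrable (measure_pmf (geometric_pmf (1 - r))) (\<lambda>n. exp (- \<theta> * real n))"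
    and "measure_pmf.expectation (geometric_pmf (1 - r)) (\<lambda>n. exp (- \<theta> * real n))
      = (1 - r) / (1 - r * exp (- \<theta>))"
proof -
  have "r * exp (- \<theta>) \<le> r" using assms by (intro mult_left_le) auto
  then have "r * exp (- \<theta>) < 1" using \<open>r < 1\<close> by (rule le_less_trans)
  then have "norm (r * exp (- \<theta>)) < 1" using assms by (simp add: abs_mult)
  from sums_mult[OF geometric_sums[OF this], of "1 - r"]
  have "(\<lambda>n. pmf (geometric_pmf (1 - r)) n * exp (- \<theta> * real n)) sums
          ((1 - r) / (1 - r * exp (- \<theta>)))"
    using assms by (simp add: power_mult_distrib mult_ac flip: exp_of_nat_mult)
  from nat_pmf_expectation[OF _ this]
  show "integrable (measure_pmf (geometric_pmf (1 - r))) (\<lambda>n. exp (- \<theta> * real n))"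
    and "measure_pmf.expectation (geometric_pmf (1 - r)) (\<lambda>n. exp (- \<theta> * real n))
      = (1 - r) / (1 - r * exp (- \<theta>))" by simp_all
qed

lemma expectation_pair_pmf_mult:
  fixes g :: "'a \<Rightarrow> real" and h :: "'b \<Rightarrow> real"
  assumes "\<And>x. 0 \<le> g x" "\<And>y. 0 \<le> h y"
  shows "measure_pmf.expectation (pair_pmf p q) (\<lambda>\<omega>. g (fst \<omega>) * h (snd \<omega>))
    = measure_pmf.expectation p g * measure_pmf.expectation q h"
proof -
  have "(\<integral>\<^sup>+\<omega>. ennreal (g (fst \<omega>) * h (snd \<omega>)) \<partial>pair_pmf p q)
      = (\<integral>\<^sup>+x. ennreal (g x) \<partial>p) * (\<integral>\<^sup>+y. ennreal (h y) \<partial>q)"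
    using assms
    by (simp add: nn_integral_pair_pmf' ennreal_mult nn_integral_cmult nn_integral_multc)
  then show ?thesis
    using assms by (simp add: integral_eq_nn_integral enn2real_mult)
qed

lemma aux_laplace:
  assumes "0 < \<kappa> 1" "\<And>i. i \<in> {class_size \<kappa> f (\<kappa> 1)<..f} \<Longrightarrow> \<kappa> 1 < \<kappa> i" "0 \<le> \<theta>"
  shows "measure_pmf.expectation (aux_pmf \<kappa> f) (\<lambda>\<omega>. exp (- \<theta> * (aux_M \<omega> + aux_S \<kappa> f \<omega>)))
    = exp (- \<kappa> 1 * (1 - exp (- \<theta>))) *
      (\<Prod>i\<in>{class_size \<kappa> f (\<kappa> 1)<..f}. (1 - \<kappa> 1 / \<kappa> i) / (1 - \<kappa> 1 / \<kappa> i * exp (- \<theta>)))"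
proof -
  let ?A = "{class_size \<kappa> f (\<kappa> 1)<..f}"
  have r: "0 < \<kappa> 1 / \<kappa> i" "\<kappa> 1 / \<kappa> i < 1" if "i \<in> ?A" for i
    using assms(1) assms(2)[OF that] by auto
  have "measure_pmf.expectation (aux_pmf \<kappa> f) (\<lambda>\<omega>. exp (- \<theta> * (aux_M \<omega> + aux_S \<kappa> f \<omega>)))
      = measure_pmf.expectation (aux_pmf \<kappa> f)
          (\<lambda>\<omega>. exp (- \<theta> * real (fst \<omega>)) * (\<Prod>i\<in>?A. exp (- \<theta> * real (snd \<omega> i))))"
    by (simp add: aux_M_def aux_S_def ring_distribs sum_distrib_left mult.commute flip: exp_sum exp_add)
  also have "\<dots> = measure_pmf.expectation (poisson_pmf (\<kappa> 1)) (\<lambda>n. exp (- \<theta> * real n)) *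
      measure_pmf.expectation (Pi_pmf ?A 0 (\<lambda>i. geometric_pmf (1 - \<kappa> 1 / \<kappa> i)))
        (\<lambda>l. \<Prod>i\<in>?A. exp (- \<theta> * real (l i)))"
    unfolding aux_pmf_def
    by (rule expectation_pair_pmf_mult) (auto intro: prod_nonneg)
  also have "measure_pmf.expectation (poisson_pmf (\<kappa> 1)) (\<lambda>n. exp (- \<theta> * real n)) =
      exp (- \<kappa> 1 * (1 - exp (- \<theta>)))"
    by (rule poisson_laplace) fact
  also have "measure_pmf.expectation (Pi_pmf ?A 0 (\<lambda>i. geometric_pmf (1 - \<kappa> 1 / \<kappa> i)))
        (\<lambda>l. \<Prod>i\<in>?A. exp (- \<theta> * real (l i))) =
      (\<Prod>i\<in>?A. measure_pmf.expectation (geometric_pmf (1 - \<kappa> 1 / \<kappa> i)) (\<lambda>n. exp (- \<theta> * real n)))"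
    using r assms(3) by (intro expectation_prod_Pi_pmf geometric_laplace) auto
  also have "\<dots> = (\<Prod>i\<in>?A. (1 - \<kappa> 1 / \<kappa> i) / (1 - \<kappa> 1 / \<kappa> i * exp (- \<theta>)))"
    using r assms(3) by (intro prod.cong refl geometric_laplace) auto
  finally show ?thesis .
qed


section \<open>Filament classes\<close>

text \<open>
  \<open>\<kappa> m i\<close> is the dissociation constant of filament \<open>i\<close>, \<open>\<kappa>\<^sub>c m j\<close> that of class \<open>j\<close>, and \<open>\<rho> j\<close> the
  ratio of class \<open>j\<close>, which does not depend on \<open>m\<close>.
\<close>

locale filament_system =
  fixes K :: nat and f :: "nat \<Rightarrow> nat" and \<kappa> \<kappa>\<^sub>c :: "nat \<Rightarrow> nat \<Rightarrow> real" and \<rho> :: "nat \<Rightarrow> real"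
  assumes K_pos: "1 \<le> K"
    and f_pos: "\<And>m. 1 \<le> m \<Longrightarrow> 1 \<le> f m"
    and \<kappa>_pos: "\<And>m. 1 \<le> m \<Longrightarrow> 0 < \<kappa> m 1"
    and \<kappa>_mono: "\<And>m. 1 \<le> m \<Longrightarrow> mono_on {1..f m} (\<kappa> m)"
    and \<kappa>_class: "\<And>m i. 1 \<le> m \<Longrightarrow> i \<in> {1..f m} \<Longrightarrow> \<kappa> m i \<in> \<kappa>\<^sub>c m ` {1..K}"
    and \<kappa>\<^sub>c_mono: "\<And>m. 1 \<le> m \<Longrightarrow> strict_mono_on {1..K} (\<kappa>\<^sub>c m)"
    and class_size_pos: "\<And>m j. 1 \<le> m \<Longrightarrow> j \<in> {1..K} \<Longrightarrow> 1 \<le> class_size (\<kappa> m) (f m) (\<kappa>\<^sub>c m j)"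
    and ratio: "\<And>m j. 1 \<le> m \<Longrightarrow> j \<in> {1..K} \<Longrightarrow> \<kappa>\<^sub>c m 1 / \<kappa>\<^sub>c m j = \<rho> j"
begin

lemma \<kappa>1_eq:
  assumes "1 \<le> m"
  shows "\<kappa>\<^sub>c m 1 = \<kappa> m 1"
proof (rule antisym)
  obtain j where "j \<in> {1..K}" "\<kappa> m 1 = \<kappa>\<^sub>c m j" using \<kappa>_class[OF assms, of 1] f_pos[OF assms] by auto
  then show "\<kappa>\<^sub>c m 1 \<le> \<kappa> m 1"
    using strict_mono_on_leD[OF \<kappa>\<^sub>c_mono[OF assms], of 1 j] by auto
  have "{n \<in> {1..f m}. \<kappa> m n = \<kappa>\<^sub>c m 1} \<noteq> {}"
    using class_size_pos[OF assms, of 1] K_pos by (auto simp: class_size_def simp del: Collect_empty_eq)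
  then obtain n where "n \<in> {1..f m}" "\<kappa> m n = \<kappa>\<^sub>c m 1" by blast
  then show "\<kappa> m 1 \<le> \<kappa>\<^sub>c m 1"
    using mono_onD[OF \<kappa>_mono[OF assms], of 1 n] by auto
qed

lemma above_min_iff:
  assumes "1 \<le> m"
  shows "{class_size (\<kappa> m) (f m) (\<kappa> m 1)<..f m} = {i \<in> {1..f m}. \<kappa> m 1 < \<kappa> m i}"
proof -
  let ?B = "{n \<in> {1..f m}. \<kappa> m n = \<kappa> m 1}"
  have mono: "\<kappa> m i \<le> \<kappa> m k" if "1 \<le> i" "i \<le> k" "k \<le> f m" for i k
    using mono_onD[OF \<kappa>_mono[OF assms], of i k] that by auto
  have B: "i \<in> ?B" if "k \<in> ?B" "1 \<le> i" "i \<le> k" for i k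
    using mono[of 1 i] mono[of i k] that by auto
  have "1 \<in> ?B" using f_pos[OF assms] by auto
  then have M: "Max ?B \<in> ?B" by (intro Max_in) auto
  define t where "t = Max ?B"
  have "i \<in> ?B \<longleftrightarrow> i \<in> {1..t}" for i
    using B[OF M, of i] Max_ge[of ?B i] unfolding t_def by auto
  then have t: "?B = {1..t}" by blast
  then have "card ?B = t" by simp
  then have "?B = {1..card ?B}" using t by (simp only:)
  then have *: "?B = {1..class_size (\<kappa> m) (f m) (\<kappa> m 1)}" unfolding class_size_def .
  have "i \<in> {class_size (\<kappa> m) (f m) (\<kappa> m 1)<..f m} \<longleftrightarrow> i \<in> {1..f m} \<and> i \<notin> ?B" for i
    unfolding * by auto
  moreover have "i \<in> {1..f m} \<and> i \<notin> ?B \<longleftrightarrow> i \<in> {i \<in> {1..f m}. \<kappa> m 1 < \<kappa> m i}" for i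
    using mono[of 1 i] by auto
  ultimately show ?thesis by blast
qed

lemma sum_classes:
  fixes g :: "real \<Rightarrow> real"
  assumes "1 \<le> m"
  shows "(\<Sum>i\<in>{class_size (\<kappa> m) (f m) (\<kappa> m 1)<..f m}. g (\<kappa> m i)) =
    (\<Sum>j=2..K. real (class_size (\<kappa> m) (f m) (\<kappa>\<^sub>c m j)) * g (\<kappa>\<^sub>c m j))"
proof -
  let ?C = "\<lambda>j. {n \<in> {1..f m}. \<kappa> m n = \<kappa>\<^sub>c m j}"
  have lt: "\<kappa>\<^sub>c m j < \<kappa>\<^sub>c m k" if "j \<in> {1..K}" "k \<in> {1..K}" "j < k" for j k
    using strict_mono_onD[OF \<kappa>\<^sub>c_mono[OF assms]] that by blast
  have "i \<in> {i \<in> {1..f m}. \<kappa> m 1 < \<kappa> m i} \<longleftrightarrow> i \<in> (\<Union>j\<in>{2..K}. ?C j)" for i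
  proof
    assume i: "i \<in> {i \<in> {1..f m}. \<kappa> m 1 < \<kappa> m i}"
    then obtain j where "j \<in> {1..K}" "\<kappa> m i = \<kappa>\<^sub>c m j" using \<kappa>_class[OF assms, of i] by auto
    moreover have "j \<noteq> 1" using i calculation \<kappa>1_eq[OF assms] by auto
    ultimately show "i \<in> (\<Union>j\<in>{2..K}. ?C j)" using i by auto
  next
    assume "i \<in> (\<Union>j\<in>{2..K}. ?C j)"
    then show "i \<in> {i \<in> {1..f m}. \<kappa> m 1 < \<kappa> m i}"
      using lt[of 1] \<kappa>1_eq[OF assms] by auto
  qed
  then have "{class_size (\<kappa> m) (f m) (\<kappa> m 1)<..f m} = (\<Union>j\<in>{2..K}. ?C j)"
    unfolding above_min_iff[OF assms] by blast
  moreover have "?C j \<inter> ?C k = {}" if "j \<in> {2..K}" "k \<in> {2..K}" "j \<noteq> k" for j k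
    using lt[of j k] lt[of k j] that by (cases j k rule: linorder_cases) auto
  ultimately have "(\<Sum>i\<in>{class_size (\<kappa> m) (f m) (\<kappa> m 1)<..f m}. g (\<kappa> m i)) =
      (\<Sum>j=2..K. \<Sum>i\<in>?C j. g (\<kappa> m i))"
    by (simp add: sum.UNION_disjoint)
  also have "\<dots> = (\<Sum>j=2..K. real (class_size (\<kappa> m) (f m) (\<kappa>\<^sub>c m j)) * g (\<kappa>\<^sub>c m j))"
    by (intro sum.cong refl) (simp add: class_size_def)
  finally show ?thesis .
qed

text \<open>The limit in \<open>aux_Lambda\<close> exists for \<open>\<theta> \<ge> 0\<close> and is given by the expected formula.\<close>

lemma aux_Lambda_eq:
  assumes fbar: "\<And>j. j \<in> {2..K} \<Longrightarrow>
      (\<lambda>m. real (class_size (\<kappa> m) (f m) (\<kappa>\<^sub>c m j)) / real m) \<longlonglongrightarrow> fbar j"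
    and \<kappa>bar: "(\<lambda>m. measure_pmf.expectation (aux_pmf (\<kappa> m) (f m)) aux_M / real m) \<longlonglongrightarrow> \<kappa>bar"
    and \<theta>: "0 \<le> \<theta>"
  shows "(\<lambda>m. 1 / real m * ln (measure_pmf.expectation (aux_pmf (\<kappa> m) (f m))
           (\<lambda>\<omega>. exp (- \<theta> * (aux_M \<omega> + aux_S (\<kappa> m) (f m) \<omega>)))))
         \<longlonglongrightarrow> - \<kappa>bar * (1 - exp (- \<theta>)) + (\<Sum>j=2..K. fbar j * ln ((1 - \<rho> j) / (1 - \<rho> j * exp (- \<theta>))))"
      (is "?L \<longlonglongrightarrow> ?R")
    and "aux_Lambda f \<kappa> \<theta> =
      - \<kappa>bar * (1 - exp (- \<theta>)) + (\<Sum>j=2..K. fbar j * ln ((1 - \<rho> j) / (1 - \<rho> j * exp (- \<theta>))))"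
proof -
  let ?n = "\<lambda>m j. real (class_size (\<kappa> m) (f m) (\<kappa>\<^sub>c m j))"
  let ?g = "\<lambda>r. ln ((1 - r) / (1 - r * exp (- \<theta>)))"
  have mean: "measure_pmf.expectation (aux_pmf (\<kappa> m) (f m)) aux_M = \<kappa> m 1" if "1 \<le> m" for m
    using \<kappa>_pos[OF that] by (simp add: aux_pmf_def aux_M_def[abs_def] poisson_mean)
  have L: "?L m = - (\<kappa> m 1 / real m) * (1 - exp (- \<theta>)) + (\<Sum>j=2..K. ?n m j / real m * ?g (\<rho> j))"
    if m: "1 \<le> m" for m
  proof -
    let ?A = "{class_size (\<kappa> m) (f m) (\<kappa> m 1)<..f m}"
    let ?q = "\<lambda>r. (1 - r) / (1 - r * exp (- \<theta>))"
    have A: "\<kappa> m 1 < \<kappa> m i" if "i \<in> ?A" for i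
      using that unfolding above_min_iff[OF m] by auto
    have q: "0 < ?q (\<kappa> m 1 / \<kappa> m i)" if "i \<in> ?A" for i
    proof -
      have r: "0 < \<kappa> m 1 / \<kappa> m i" "\<kappa> m 1 / \<kappa> m i < 1" using A[OF that] \<kappa>_pos[OF m] by auto
      moreover have "\<kappa> m 1 / \<kappa> m i * exp (- \<theta>) \<le> \<kappa> m 1 / \<kappa> m i * 1"
        using r \<theta> by (intro mult_left_mono) auto
      ultimately show ?thesis by (intro divide_pos_pos) linarith+
    qed
    have pos: "0 < (\<Prod>i\<in>?A. ?q (\<kappa> m 1 / \<kappa> m i))"
      by (rule prod_pos) (rule q)
    have "ln (exp (- \<kappa> m 1 * (1 - exp (- \<theta>))) * (\<Prod>i\<in>?A. ?q (\<kappa> m 1 / \<kappa> m i))) =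
        ln (exp (- \<kappa> m 1 * (1 - exp (- \<theta>)))) + ln (\<Prod>i\<in>?A. ?q (\<kappa> m 1 / \<kappa> m i))"
      by (rule ln_mult_pos[OF exp_gt_zero pos])
    also have "ln (\<Prod>i\<in>?A. ?q (\<kappa> m 1 / \<kappa> m i)) = (\<Sum>i\<in>?A. ?g (\<kappa> m 1 / \<kappa> m i))"
      by (rule ln_prod) (use q in fastforce)+
    also have "\<dots> = (\<Sum>j=2..K. ?n m j * ?g (\<kappa> m 1 / \<kappa>\<^sub>c m j))"
      by (rule sum_classes[OF m, of "\<lambda>x. ?g (\<kappa> m 1 / x)"])
    also have "\<dots> = (\<Sum>j=2..K. ?n m j * ?g (\<rho> j))"
    proof (intro sum.cong refl)
      fix j assume "j \<in> {2..K}"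
      then have "\<kappa> m 1 / \<kappa>\<^sub>c m j = \<rho> j"
        using ratio[OF m, of j] \<kappa>1_eq[OF m] by auto
      then show "?n m j * ?g (\<kappa> m 1 / \<kappa>\<^sub>c m j) = ?n m j * ?g (\<rho> j)" by (simp only:)
    qed
    finally have eq: "ln (exp (- \<kappa> m 1 * (1 - exp (- \<theta>))) * (\<Prod>i\<in>?A. ?q (\<kappa> m 1 / \<kappa> m i))) =
        - \<kappa> m 1 * (1 - exp (- \<theta>)) + (\<Sum>j=2..K. ?n m j * ?g (\<rho> j))"
      by (simp only: ln_exp)
    have "1 / real m * (- \<kappa> m 1 * a + (\<Sum>j=2..K. ?n m j * ?g (\<rho> j))) =
        - (\<kappa> m 1 / real m) * a + (\<Sum>j=2..K. ?n m j / real m * ?g (\<rho> j))" for a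
      by (simp add: diff_divide_distrib sum_divide_distrib)
    moreover have "measure_pmf.expectation (aux_pmf (\<kappa> m) (f m))
          (\<lambda>\<omega>. exp (- \<theta> * (aux_M \<omega> + aux_S (\<kappa> m) (f m) \<omega>))) =
        exp (- \<kappa> m 1 * (1 - exp (- \<theta>))) * (\<Prod>i\<in>?A. ?q (\<kappa> m 1 / \<kappa> m i))"
      by (rule aux_laplace) (rule \<kappa>_pos[OF m], rule A, assumption, rule \<theta>)
    ultimately show ?thesis by (simp only: eq)
  qed
  have "(\<lambda>m. \<kappa> m 1 / real m) \<longlonglongrightarrow> \<kappa>bar"
    by (rule Lim_transform_eventually[OF \<kappa>bar]) (auto intro!: eventually_sequentiallyI[of 1] simp: mean)
  then have "(\<lambda>m. - (\<kappa> m 1 / real m) * (1 - exp (- \<theta>)) + (\<Sum>j=2..K. ?n m j / real m * ?g (\<rho> j))) \<longlonglongrightarrow> ?R"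
    by (intro tendsto_intros fbar) auto
  then show lim: "?L \<longlonglongrightarrow> ?R"
    by (rule Lim_transform_eventually) (rule eventually_sequentiallyI[of 1], rule L[symmetric])
  then show "aux_Lambda f \<kappa> \<theta> = ?R"
    unfolding aux_Lambda_def by (rule limI)
qed

end

end

theory Submission
  imports Defs
begin

text \<open>
  Let \<open>a\<^sub>n\<close> be the coefficient of \<open>w\<^sup>n\<close> in \<open>exp (\<kappa>\<^sub>1 w) / (\<Prod>i. 1 - \<rho>\<^sub>i w)\<close>, for the rates that belong to
  \<open>m\<close>. Removing \<open>k\<close> units from a filament, or \<open>k\<close> free monomers, turns the system of size \<open>m\<close> into one
  of size \<open>m - k\<close>: the tail \<open>P[L\<^sub>i \<ge> k]\<close> is \<open>\<rho>\<^sub>i\<^sup>k a\<^bsub>m-k\<^esub> / a\<^sub>m\<close> and the \<open>k\<close>-th factorial moment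
  of \<open>M\<close> is \<open>\<kappa>\<^sub>1\<^sup>k a\<^bsub>m-k\<^esub> / a\<^sub>m\<close>. So no large deviation estimate is needed, only
  \<open>a\<^bsub>n-1\<^esub> / a\<^sub>n \<rightarrow> q\<close> for \<open>n\<close> at bounded distance from \<open>m\<close>.

  The sequence \<open>a\<close> is log-concave, so these ratios increase with \<open>n\<close>, and taking expectations in
  \<open>M + \<Sum>\<^sub>i L\<^sub>i = n\<close> gives \<open>n a\<^sub>n = \<kappa>\<^sub>1 a\<^bsub>n-1\<^esub> + \<Sum>\<^sub>i \<Sum>\<^sub>k \<rho>\<^sub>i\<^sup>k a\<^bsub>n-k\<^esub>\<close>. Bounding the quotients
  \<open>a\<^bsub>n-k\<^esub> / a\<^sub>n\<close> from both sides by powers of a single ratio squeezes the ratio to the root \<open>q\<close> of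
  \<open>\<kappa>bar q + \<Sum>\<^sub>j fbar\<^sub>j \<rho>\<^sub>j q / (1 - \<rho>\<^sub>j q) = 1\<close>. With \<open>\<psi>\<close> the part of the left-hand side that omits the
  class \<open>j = 1\<close>, this equation reads \<open>q = (1 - \<psi>) / (fbar\<^sub>1 + 1 - \<psi>)\<close> and
  \<open>\<psi> + \<Lambda>' (- ln q) = 0\<close>; the form with the derivative of the rate function is Legendre duality.
\<close>

section \<open>Partition functions\<close>

text \<open>This is \<open>filament_weight\<close> without the factor \<open>fact m\<close>, which
  cancels on normalisation; without it, weights for different sizes \<open>n\<close> differ only by
  powers of the rates when units are removed from a filament.\<close>

definition state_weight :: "(nat \<Rightarrow> real) \<Rightarrow> nat \<Rightarrow> nat \<Rightarrow> (nat \<Rightarrow> nat) \<Rightarrow> real" where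
  "state_weight \<kappa> f n l = (\<Prod>i=1..f. inverse (\<kappa> i) ^ l i) / fact (n - (\<Sum>i=1..f. l i))"

text \<open>The coefficient of \<open>w^n\<close> in
  \<open>exp w / (\<Prod>i. 1 - w / \<kappa> i)\<close>: the exponential stands for the free
  monomers, each geometric factor for one filament.\<close>

definition partition_fun :: "(nat \<Rightarrow> real) \<Rightarrow> nat \<Rightarrow> nat \<Rightarrow> real" where
  "partition_fun \<kappa> f n = (\<Sum>l\<in>filament_states n f. state_weight \<kappa> f n l)"

lemma state_weight_pos:
  assumes "\<And>i. i \<in> {1..f} \<Longrightarrow> 0 < \<kappa> i"
  shows "0 < state_weight \<kappa> f n l"
  unfolding state_weight_def by (intro divide_pos_pos prod_pos) (auto simp: assms)

lemma partition_fun_pos: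
  assumes "\<And>i. i \<in> {1..f} \<Longrightarrow> 0 < \<kappa> i"
  shows "0 < partition_fun \<kappa> f n"
proof -
  have "(\<lambda>_. 0) \<in> filament_states n f" by (simp add: filament_states_def)
  then show ?thesis
    unfolding partition_fun_def
    by (intro sum_pos finite_filament_states state_weight_pos assms) auto
qed

lemma expectation_stationary:
  fixes h :: "(nat \<Rightarrow> nat) \<Rightarrow> real"
  assumes "\<And>i. i \<in> {1..f} \<Longrightarrow> 0 < \<kappa> i"
  shows "measure_pmf.expectation (stationary_pmf \<kappa> m f) h =
    (\<Sum>l\<in>filament_states m f. h l * state_weight \<kappa> f m l) / partition_fun \<kappa> f m"
proof -
  have w: "filament_weight \<kappa> m f l = fact m * state_weight \<kappa> f m l" for l
    by (simp add: filament_weight_def state_weight_def)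
  have Z: "normalization_const \<kappa> m f = fact m * partition_fun \<kappa> f m"
    by (simp add: normalization_const_def partition_fun_def w sum_distrib_left)
  have pmf: "pmf (stationary_pmf \<kappa> m f) l =
      (if l \<in> filament_states m f then state_weight \<kappa> f m l / partition_fun \<kappa> f m else 0)" for l
    using pmf_stationary[of f \<kappa> m l] assms by (simp add: w Z)
  have "measure_pmf.expectation (stationary_pmf \<kappa> m f) h =
      (\<Sum>l\<in>filament_states m f. h l * pmf (stationary_pmf \<kappa> m f) l)"
    by (rule integral_measure_pmf_real) (auto simp: finite_filament_states set_pmf_iff pmf split: if_splits)
  then show ?thesis
    by (simp add: pmf sum_divide_distrib)
qed

lemma prob_stationary:
  assumes "\<And>i. i \<in> {1..f} \<Longrightarrow> 0 < \<kappa> i"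
  shows "measure_pmf.prob (stationary_pmf \<kappa> m f) {l. P l} =
    (\<Sum>l | l \<in> filament_states m f \<and> P l. state_weight \<kappa> f m l) / partition_fun \<kappa> f m"
proof -
  have "measure_pmf.prob (stationary_pmf \<kappa> m f) {l. P l} =
      measure_pmf.expectation (stationary_pmf \<kappa> m f) (indicator {l. P l})" by simp
  also have "\<dots> = (\<Sum>l\<in>filament_states m f. indicator {l. P l} l * state_weight \<kappa> f m l) / partition_fun \<kappa> f m"
    by (rule expectation_stationary) (rule assms)
  also have "(\<Sum>l\<in>filament_states m f. indicator {l. P l} l * state_weight \<kappa> f m l) =
      (\<Sum>l | l \<in> filament_states m f \<and> P l. state_weight \<kappa> f m l)"
    unfolding sum.inter_filter[OF finite_filament_states] by (intro sum.cong) auto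
  finally show ?thesis .
qed

text \<open>Adding \<open>k\<close> units to filament \<open>i\<close> maps the states of size
  \<open>n - k\<close> bijectively onto the states summed on the left. The number of free monomers
  is unchanged, so the weight only gains \<open>inverse (\<kappa> i) ^ k\<close>.\<close>

lemma sum_state_weight_ge:
  assumes i: "i \<in> {1..f}" and "k \<le> n"
  shows "(\<Sum>l | l \<in> filament_states n f \<and> k \<le> l i. state_weight \<kappa> f n l) =
    inverse (\<kappa> i) ^ k * partition_fun \<kappa> f (n - k)"
proof -
  let ?h = "\<lambda>l::nat \<Rightarrow> nat. l(i := l i + k)"
  have s: "(\<Sum>j=1..f. ?h l j) = (\<Sum>j=1..f. l j) + k" for l
  proof -
    have "sum (?h l) ({1..f} - {i}) = sum l ({1..f} - {i})" by (intro sum.cong) auto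
    then show ?thesis unfolding sum.remove[OF finite_atLeastAtMost i] by simp
  qed
  have p: "(\<Prod>j=1..f. inverse (\<kappa> j) ^ ?h l j) = inverse (\<kappa> i) ^ k * (\<Prod>j=1..f. inverse (\<kappa> j) ^ l j)" for l
  proof -
    have "(\<Prod>j\<in>{1..f} - {i}. inverse (\<kappa> j) ^ ?h l j) = (\<Prod>j\<in>{1..f} - {i}. inverse (\<kappa> j) ^ l j)"
      by (intro prod.cong) auto
    then show ?thesis
      unfolding prod.remove[OF finite_atLeastAtMost i] by (simp add: power_add mult_ac)
  qed
  have w: "state_weight \<kappa> f n (?h l) = inverse (\<kappa> i) ^ k * state_weight \<kappa> f (n - k) l" for l
    unfolding state_weight_def s p by (simp add: diff_diff_left add.commute)
  have "(\<Sum>l | l \<in> filament_states n f \<and> k \<le> l i. state_weight \<kappa> f n l) =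
      (\<Sum>l\<in>filament_states (n - k) f. state_weight \<kappa> f n (?h l))"
  proof (rule sum.reindex_bij_witness[of _ ?h "\<lambda>l. l(i := l i - k)"], goal_cases)
    \<comment> \<open>Raising the lowered state again gives back \<open>l\<close>, so
      \<open>s\<close> bounds the total of the lowered state by \<open>n - k\<close>.\<close>
    case (2 l)
    then have "(\<Sum>j=1..f. ?h (l(i := l i - k)) j) \<le> n"
      by (simp add: filament_states_def)
    then show ?case using 2 assms unfolding s by (auto simp: filament_states_def)
  next
    case (4 l)
    have "(\<Sum>j=1..f. ?h l j) \<le> n" unfolding s using 4 assms(2) by (auto simp: filament_states_def)
    then show ?case using 4 assms by (auto simp: filament_states_def)
  qed auto
  also have "\<dots> = inverse (\<kappa> i) ^ k * partition_fun \<kappa> f (n - k)"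
    unfolding w by (simp add: partition_fun_def sum_distrib_left)
  finally show ?thesis .
qed

lemma sum_state_weight_ge_0:
  assumes i: "i \<in> {1..f}" and "n < k"
  shows "(\<Sum>l | l \<in> filament_states n f \<and> k \<le> l i. state_weight \<kappa> f n l) = 0"
proof -
  have "l i \<le> n" if "l \<in> filament_states n f" for l
  proof -
    have "l i \<le> (\<Sum>i=1..f. l i)" using i by (intro member_le_sum) auto
    then show ?thesis using that by (simp add: filament_states_def)
  qed
  then have "{l. l \<in> filament_states n f \<and> k \<le> l i} = {}" using assms by force
  then show ?thesis by (simp only: sum.empty)
qed

section \<open>Recursion over the filaments and log-concavity\<close>

lemma partition_fun_0: "partition_fun \<kappa> 0 n = 1 / fact n"
proof -
  have "filament_states n 0 = {\<lambda>_. 0}" by (auto simp: filament_states_def)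
  then show ?thesis by (simp add: partition_fun_def state_weight_def)
qed

lemma sum_state_weight_eq_0:
  "(\<Sum>l | l \<in> filament_states n (Suc f) \<and> \<not> 1 \<le> l (Suc f). state_weight \<kappa> (Suc f) n l) =
    partition_fun \<kappa> f n"
  unfolding partition_fun_def
proof (rule sum.cong)
  show "{l. l \<in> filament_states n (Suc f) \<and> \<not> 1 \<le> l (Suc f)} = filament_states n f"
    by (auto simp: filament_states_def not_less_eq_eq) (metis le_antisym not_less_eq_eq)
  show "state_weight \<kappa> (Suc f) n l = state_weight \<kappa> f n l" if "l \<in> filament_states n f" for l
  proof -
    have "l (Suc f) = 0" using that by (simp add: filament_states_def)
    then show ?thesis by (simp add: state_weight_def)
  qed
qed

lemma partition_fun_split:
  "partition_fun \<kappa> (Suc f) n = partition_fun \<kappa> f n +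
    (\<Sum>l | l \<in> filament_states n (Suc f) \<and> 1 \<le> l (Suc f). state_weight \<kappa> (Suc f) n l)"
proof -
  let ?S = "filament_states n (Suc f)"
  have "partition_fun \<kappa> (Suc f) n = (\<Sum>l\<in>{l \<in> ?S. \<not> 1 \<le> l (Suc f)} \<union> {l \<in> ?S. 1 \<le> l (Suc f)}.
      state_weight \<kappa> (Suc f) n l)"
    unfolding partition_fun_def by (intro sum.cong) auto
  also have "\<dots> = (\<Sum>l | l \<in> ?S \<and> \<not> 1 \<le> l (Suc f). state_weight \<kappa> (Suc f) n l) +
      (\<Sum>l | l \<in> ?S \<and> 1 \<le> l (Suc f). state_weight \<kappa> (Suc f) n l)"
    by (rule sum.union_disjoint) (auto simp: finite_filament_states)
  finally show ?thesis unfolding sum_state_weight_eq_0 .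
qed

lemma partition_fun_Suc_0: "partition_fun \<kappa> (Suc f) 0 = partition_fun \<kappa> f 0"
  unfolding partition_fun_split by (subst sum_state_weight_ge_0) auto

text \<open>Either the last filament is empty or one unit can be taken off it. On generating
  functions this is division by \<open>1 - w / \<kappa> (Suc f)\<close>.\<close>

lemma partition_fun_Suc_Suc:
  "partition_fun \<kappa> (Suc f) (Suc n) =
    partition_fun \<kappa> f (Suc n) + inverse (\<kappa> (Suc f)) * partition_fun \<kappa> (Suc f) n"
  unfolding partition_fun_split[of \<kappa> f "Suc n"] by (subst sum_state_weight_ge) auto

text \<open>Expanding one factor in each product by the recursion cancels the terms with
  \<open>c\<close>: \<open>b (n + 1)^2 - b n * b (n + 2)\<close> equals
  \<open>a (n + 1) * b (n + 1) - a (n + 2) * b n\<close>. The claim thus reduces to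
  \<open>key\<close>, which is accessible to induction.\<close>

lemma log_concave_geometric_convolution:
  fixes a b :: "nat \<Rightarrow> real"
  assumes a: "\<And>n. 0 < a n" "\<And>n. a n * a (n + 2) \<le> a (n + 1) ^ 2"
    and b: "b 0 = a 0" "\<And>n. b (Suc n) = a (Suc n) + c * b n" and "0 \<le> c"
  shows "b n * b (n + 2) \<le> b (n + 1) ^ 2"
proof -
  have bpos: "0 < b n" for n
    by (induction n) (simp_all add: a b \<open>0 \<le> c\<close> add_pos_nonneg)
  have key: "a (n + 2) * b n \<le> a (n + 1) * b (n + 1)" for n
  proof (induction n)
    case 0
    have "0 \<le> a 1 * (c * b 0)"
      using a(1)[of 1] bpos[of 0] \<open>0 \<le> c\<close> by simp
    then show ?case using a(2)[of 0] b(2)[of 0] by (simp add: b(1) power2_eq_square algebra_simps)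
  next
    case (Suc n)
    \<comment> \<open>The extra factor \<open>a (n + 2)\<close> lets the induction hypothesis be
      chained with the log-concavity of \<open>a\<close>; it is cancelled afterwards.\<close>
    have "a (n + 2) * (a (n + 3) * b n) \<le> a (n + 3) * (a (n + 1) * b (n + 1))"
      using mult_left_mono[OF Suc, of "a (n + 3)"] a(1)[of "n + 3"] by (simp add: mult_ac)
    also have "\<dots> = (a (n + 1) * a (n + 3)) * b (n + 1)" by simp
    also have "\<dots> \<le> a (n + 2) ^ 2 * b (n + 1)"
      using a(2)[of "n + 1"] bpos[of "n + 1"] by (intro mult_right_mono) (auto simp: numeral_3_eq_3)
    finally have "a (n + 3) * b n \<le> a (n + 2) * b (n + 1)"
      using a(1)[of "n + 2"] by (simp add: power2_eq_square mult.assoc)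
    then have "c * (a (n + 3) * b n) \<le> c * (a (n + 2) * b (n + 1))"
      using \<open>0 \<le> c\<close> by (rule mult_left_mono)
    moreover have "a (n + 3) * a (n + 1) \<le> a (n + 2) * a (n + 2)"
      using a(2)[of "n + 1"] by (simp add: numeral_3_eq_3 power2_eq_square mult.commute)
    ultimately show ?case
      using b(2)[of n] b(2)[of "Suc n"] by (simp add: numeral_3_eq_3 algebra_simps)
  qed
  show ?thesis using key[of n] b(2)[of n] b(2)[of "Suc n"]
    by (simp add: power2_eq_square algebra_simps)
qed

text \<open>The sequence \<open>1 / fact n\<close> of the system without filaments is log-concave,
  and each further filament is a convolution with a geometric sequence.\<close>

lemma partition_fun_log_concave:
  assumes "\<And>i. i \<in> {1..f} \<Longrightarrow> 0 < \<kappa> i"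
  shows "partition_fun \<kappa> f n * partition_fun \<kappa> f (n + 2) \<le> partition_fun \<kappa> f (n + 1) ^ 2"
  using assms
proof (induction f arbitrary: n)
  case 0
  have "fact (Suc n) * fact (Suc n) \<le> (fact n * fact (Suc (Suc n)) :: real)"
    by (simp add: algebra_simps)
  then have "1 / (fact n * fact (Suc (Suc n))) \<le> (1 / (fact (Suc n) * fact (Suc n)) :: real)"
    by (intro frac_le) auto
  then show ?case by (simp add: partition_fun_0 power2_eq_square del: fact_Suc)
next
  case (Suc f)
  show ?case
    by (rule log_concave_geometric_convolution[of "partition_fun \<kappa> f", OF _ _ partition_fun_Suc_0 partition_fun_Suc_Suc])
       (use Suc in \<open>auto intro!: partition_fun_pos less_imp_le\<close>)
qed

text \<open>The factor M turns \<open>1 / M!\<close> into \<open>1 / (M - 1)!\<close>, and states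
  with M = 0 drop out. The arbitrary \<open>h\<close> allows a second application, which yields the
  second factorial moment.\<close>

lemma sum_free_monomers:
  fixes h :: "(nat \<Rightarrow> nat) \<Rightarrow> real"
  shows "(\<Sum>l\<in>filament_states (Suc n) f. free_monomers (Suc n) f l * h l * state_weight \<kappa> f (Suc n) l) =
    (\<Sum>l\<in>filament_states n f. h l * state_weight \<kappa> f n l)"
proof -
  let ?t = "\<lambda>l. free_monomers (Suc n) f l * h l * state_weight \<kappa> f (Suc n) l"
  have "sum ?t (filament_states (Suc n) f) = sum ?t (filament_states n f)"
  proof (rule sum.mono_neutral_right)
    show "\<forall>l\<in>filament_states (Suc n) f - filament_states n f. ?t l = 0"
    proof
      fix l assume "l \<in> filament_states (Suc n) f - filament_states n f"
      then have "(\<Sum>i=1..f. l i) = Suc n" by (auto simp: filament_states_def)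
      then have "free_monomers (Suc n) f l = 0"
        unfolding free_monomers_def by (simp flip: of_nat_sum)
      then show "?t l = 0" by simp
    qed
  qed (rule finite_filament_states, auto simp: filament_states_def)
  also have "\<dots> = (\<Sum>l\<in>filament_states n f. h l * state_weight \<kappa> f n l)"
  proof (rule sum.cong)
    fix l assume "l \<in> filament_states n f"
    then have "(\<Sum>i=1..f. l i) \<le> n" by (simp add: filament_states_def)
    then obtain d where d: "n = (\<Sum>i=1..f. l i) + d" by (auto simp: le_iff_add)
    have "Suc n - (\<Sum>i=1..f. l i) = Suc d" "n - (\<Sum>i=1..f. l i) = d" using d by auto
    moreover have "free_monomers (Suc n) f l = real (Suc d)"
      unfolding free_monomers_def d by simp
    ultimately show "?t l = h l * state_weight \<kappa> f n l"
      unfolding state_weight_def by (simp del: of_nat_Suc add: field_simps)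
  qed simp
  finally show ?thesis .
qed

text \<open>Conservation of mass, free monomers plus filament lengths equal to \<open>Suc n\<close>,
  summed against the weights. The lengths enter through their tails, which are known in closed
  form.\<close>

lemma partition_fun_mass_balance:
  "real (Suc n) * partition_fun \<kappa> f (Suc n) = partition_fun \<kappa> f n +
    (\<Sum>i=1..f. \<Sum>k\<le>n. inverse (\<kappa> i) ^ Suc k * partition_fun \<kappa> f (n - k))"
proof -
  let ?S = "filament_states (Suc n) f" and ?w = "state_weight \<kappa> f (Suc n)"
  have L: "(\<Sum>l\<in>?S. real (l i) * ?w l) = (\<Sum>k\<le>n. inverse (\<kappa> i) ^ Suc k * partition_fun \<kappa> f (n - k))"
    if i: "i \<in> {1..f}" for i
  proof -
    \<comment> \<open>A length is the number of thresholds \<open>Suc k\<close> that it reaches;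
      since \<open>l i \<le> Suc n\<close>, thresholds up to \<open>Suc n\<close> suffice.\<close>
    have "real (l i) = (\<Sum>k\<le>n. if Suc k \<le> l i then 1 else 0)" if "l \<in> ?S" for l
    proof -
      have "l i \<le> (\<Sum>i=1..f. l i)" using i by (intro member_le_sum) auto
      then have "l i \<le> Suc n" using that by (simp add: filament_states_def)
      then have "{k. k \<le> n \<and> Suc k \<le> l i} = {..<l i}" by auto
      then show ?thesis by (simp flip: sum.inter_filter add: atMost_def)
    qed
    then have "(\<Sum>l\<in>?S. real (l i) * ?w l) = (\<Sum>l\<in>?S. \<Sum>k\<le>n. if Suc k \<le> l i then ?w l else 0)"
      by (intro sum.cong refl) (simp add: sum_distrib_right if_distrib[of "\<lambda>x. x * _"] cong: if_cong)
    also have "\<dots> = (\<Sum>k\<le>n. \<Sum>l | l \<in> ?S \<and> Suc k \<le> l i. ?w l)"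
      by (subst sum.swap) (simp add: sum.inter_filter finite_filament_states)
    also have "\<dots> = (\<Sum>k\<le>n. inverse (\<kappa> i) ^ Suc k * partition_fun \<kappa> f (n - k))"
      using i by (intro sum.cong refl) (simp add: sum_state_weight_ge del: power_Suc)
    finally show ?thesis .
  qed
  have "real (Suc n) * partition_fun \<kappa> f (Suc n) =
      (\<Sum>l\<in>?S. (free_monomers (Suc n) f l + (\<Sum>i=1..f. real (l i))) * ?w l)"
    unfolding partition_fun_def sum_distrib_left by (simp add: free_monomers_def)
  also have "\<dots> = (\<Sum>l\<in>?S. free_monomers (Suc n) f l * 1 * ?w l) + (\<Sum>l\<in>?S. \<Sum>i=1..f. real (l i) * ?w l)"
    by (simp add: distrib_right sum.distrib sum_distrib_right)
  also have "(\<Sum>l\<in>?S. free_monomers (Suc n) f l * 1 * ?w l) = partition_fun \<kappa> f n"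
    unfolding sum_free_monomers by (simp add: partition_fun_def)
  also have "(\<Sum>l\<in>?S. \<Sum>i=1..f. real (l i) * ?w l) =
     (\<Sum>i=1..f. \<Sum>k\<le>n. inverse (\<kappa> i) ^ Suc k * partition_fun \<kappa> f (n - k))"
    by (subst sum.swap) (intro sum.cong refl L)
  finally show ?thesis .
qed

section \<open>Log-concave sequences\<close>

lemma log_concave_ratio_mono:
  fixes a :: "nat \<Rightarrow> real"
  assumes "\<And>n. 0 < a n" "\<And>n. a n * a (n + 2) \<le> a (n + 1) ^ 2"
  shows "mono (\<lambda>n. a n / a (Suc n))"
  unfolding mono_iff_le_Suc
  using assms by (simp add: field_simps power2_eq_square)

text \<open>The quotient \<open>a (Suc n - k) / a (Suc n)\<close> is a product of \<open>k\<close>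
  consecutive ratios, the last of which is the largest.\<close>

lemma log_concave_le_power:
  fixes a :: "nat \<Rightarrow> real"
  assumes a: "\<And>n. 0 < a n" "\<And>n. a n * a (n + 2) \<le> a (n + 1) ^ 2" and "k \<le> Suc n"
  shows "a (Suc n - k) \<le> (a n / a (Suc n)) ^ k * a (Suc n)"
  using \<open>k \<le> Suc n\<close>
proof (induction k)
  case (Suc k)
  let ?u = "a n / a (Suc n)"
  have "a (n - k) / a (Suc (n - k)) \<le> ?u"
    by (rule monoD[OF log_concave_ratio_mono[OF a]]) simp
  then have "a (n - k) \<le> ?u * a (Suc (n - k))"
    using a(1) by (simp add: pos_divide_le_eq)
  also have "\<dots> \<le> ?u * (?u ^ k * a (Suc n))"
    using Suc a(1) by (intro mult_left_mono) (auto simp: Suc_diff_le less_imp_le)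
  finally show ?case by (simp add: mult_ac)
qed simp

text \<open>Here the ratio at \<open>n\<close> is the smallest of those involved. The top index lies
  \<open>N\<close> places further up, which is why at most \<open>Suc N\<close> factors can be
  bounded.\<close>

lemma log_concave_ge_power:
  fixes a :: "nat \<Rightarrow> real"
  assumes a: "\<And>n. 0 < a n" "\<And>n. a n * a (n + 2) \<le> a (n + 1) ^ 2" and "k \<le> Suc N"
  shows "(a n / a (Suc n)) ^ k * a (Suc (n + N)) \<le> a (Suc (n + N) - k)"
  using \<open>k \<le> Suc N\<close>
proof (induction k)
  case (Suc k)
  let ?u = "a n / a (Suc n)"
  have "?u ^ Suc k * a (Suc (n + N)) = ?u * (?u ^ k * a (Suc (n + N)))" by simp
  also have "\<dots> \<le> ?u * a (Suc (n + N - k))"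
    using Suc a(1) by (intro mult_left_mono) (auto simp: Suc_diff_le less_imp_le)
  also have "?u \<le> a (n + N - k) / a (Suc (n + N - k))"
    using Suc.prems by (intro monoD[OF log_concave_ratio_mono[OF a]]) simp
  then have "?u * a (Suc (n + N - k)) \<le> a (n + N - k)"
    using a(1) by (simp add: pos_le_divide_eq)
  finally show ?case by simp
qed simp

section \<open>Bounds on a single ratio from the mass balance\<close>

lemma mult_lt_one:
  fixes r v :: real
  assumes "0 < r \<and> r \<le> 1" "v < 1"
  shows "r * v < 1"
proof (cases "0 \<le> v")
  case True
  then have "r * v \<le> v" using assms by (intro mult_left_le_one_le) auto
  then show ?thesis using assms by linarith
next
  case False
  then have "r * v \<le> 0" using assms by (intro mult_nonneg_nonpos) auto
  then show ?thesis by linarith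
qed

lemma sum_geometric_Suc_le:
  fixes z :: real
  assumes "0 \<le> z" "z < 1"
  shows "(\<Sum>k\<le>n. z ^ Suc k) \<le> z / (1 - z)"
proof -
  have "(\<Sum>k\<le>n. z ^ Suc k) = z * (\<Sum>k<Suc n. z ^ k)"
    by (simp add: sum_distrib_left lessThan_Suc_atMost)
  also have "\<dots> = z * ((1 - z ^ Suc n) / (1 - z))"
    using assms by (subst sum_gp_strict) auto
  also have "\<dots> \<le> z * (1 / (1 - z))"
    using assms by (intro mult_left_mono divide_right_mono) auto
  finally show ?thesis by simp
qed

lemma sum_geometric_Suc_tendsto:
  fixes z :: real
  assumes "0 \<le> z" "z < 1"
  shows "(\<lambda>n. \<Sum>k\<le>n. z ^ Suc k) \<longlonglongrightarrow> z / (1 - z)"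
proof -
  have "(\<lambda>k. z ^ Suc k) sums (z / (1 - z))"
    using sums_mult[OF geometric_sums[of z], of z] assms by simp
  then show ?thesis by (simp add: sums_def_le)
qed

text \<open>If the ratio at \<open>n\<close> is at most \<open>v\<close>, every
  \<open>a (n - k)\<close> is at most \<open>v ^ Suc k * a (Suc n)\<close>, and the balance at size
  \<open>Suc n\<close> is dominated by full geometric series. A \<open>v\<close> that violates the
  conclusion is therefore a lower bound for the ratio.\<close>

lemma ratio_lower_balance:
  fixes a \<rho> d :: "nat \<Rightarrow> real"
  assumes a: "\<And>n. 0 < a n" "\<And>n. a n * a (n + 2) \<le> a (n + 1) ^ 2"
    and bal: "real (Suc n) * a (Suc n) = c * a n + (\<Sum>j\<in>J. d j * (\<Sum>k\<le>n. \<rho> j ^ Suc k * a (n - k)))"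
    and c: "0 \<le> c" and d: "\<And>j. j \<in> J \<Longrightarrow> 0 \<le> d j" and \<rho>: "\<And>j. j \<in> J \<Longrightarrow> 0 < \<rho> j \<and> \<rho> j \<le> 1"
    and v: "a n / a (Suc n) \<le> v" "v < 1"
  shows "real (Suc n) \<le> c * v + (\<Sum>j\<in>J. d j * (\<rho> j * v / (1 - \<rho> j * v)))"
proof -
  let ?A = "a (Suc n)" and ?u = "a n / a (Suc n)"
  have u: "0 < ?u" using a by simp
  have "0 < v" using u v by linarith
  have ak: "a (n - k) \<le> v ^ Suc k * ?A" if "k \<le> n" for k
  proof -
    have "a (n - k) \<le> ?u ^ Suc k * ?A"
      using log_concave_le_power[OF a, of "Suc k" n] that by simp
    also have "\<dots> \<le> v ^ Suc k * ?A"
      using u v a(1)[of "Suc n"] by (intro mult_right_mono power_mono) auto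
    finally show ?thesis .
  qed
  have "(\<Sum>k\<le>n. \<rho> j ^ Suc k * a (n - k)) \<le> \<rho> j * v / (1 - \<rho> j * v) * ?A" if j: "j \<in> J" for j
  proof -
    have rv: "0 \<le> \<rho> j * v" "\<rho> j * v < 1"
      using \<rho>[OF j] \<open>0 < v\<close> mult_lt_one[OF \<rho>[OF j] v(2)] by simp_all
    have "(\<Sum>k\<le>n. \<rho> j ^ Suc k * a (n - k)) \<le> (\<Sum>k\<le>n. \<rho> j ^ Suc k * (v ^ Suc k * ?A))"
      using \<rho>[OF j] ak by (intro sum_mono mult_left_mono) auto
    also have "\<dots> = (\<Sum>k\<le>n. (\<rho> j * v) ^ Suc k) * ?A"
      by (simp only: sum_distrib_right power_mult_distrib mult.assoc)
    also have "\<dots> \<le> \<rho> j * v / (1 - \<rho> j * v) * ?A"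
      using sum_geometric_Suc_le[OF rv] a(1)[of "Suc n"] by (intro mult_right_mono) auto
    finally show ?thesis .
  qed
  then have "(\<Sum>j\<in>J. d j * (\<Sum>k\<le>n. \<rho> j ^ Suc k * a (n - k))) \<le>
      (\<Sum>j\<in>J. d j * (\<rho> j * v / (1 - \<rho> j * v) * ?A))"
    using d by (intro sum_mono mult_left_mono) auto
  moreover have "c * a n \<le> c * (v * ?A)"
    using ak[of 0] c by (intro mult_left_mono) auto
  ultimately have "real (Suc n) * ?A \<le> (c * v + (\<Sum>j\<in>J. d j * (\<rho> j * v / (1 - \<rho> j * v)))) * ?A"
    unfolding bal distrib_right sum_distrib_right[of _ J] mult.assoc by (rule add_mono[rotated])
  then show ?thesis using a(1)[of "Suc n"] by (simp only: mult_le_cancel_right_pos)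
qed

text \<open>The balance is taken at size \<open>Suc (n + N)\<close>, so that the
  \<open>Suc N\<close> terms nearest the top involve only ratios at \<open>n\<close> or later, all
  at least \<open>v\<close>. The remaining terms are nonnegative and are dropped; the price is the
  \<open>N\<close> on the right, which is negligible against \<open>m\<close>.\<close>

lemma ratio_upper_balance:
  fixes a \<rho> d :: "nat \<Rightarrow> real"
  assumes a: "\<And>n. 0 < a n" "\<And>n. a n * a (n + 2) \<le> a (n + 1) ^ 2"
    and bal: "\<And>n. real (Suc n) * a (Suc n) = c * a n + (\<Sum>j\<in>J. d j * (\<Sum>k\<le>n. \<rho> j ^ Suc k * a (n - k)))"
    and c: "0 \<le> c" and d: "\<And>j. j \<in> J \<Longrightarrow> 0 \<le> d j" and \<rho>: "\<And>j. j \<in> J \<Longrightarrow> 0 < \<rho> j \<and> \<rho> j \<le> 1"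
    and v: "0 \<le> v" "v \<le> a n / a (Suc n)"
  shows "c * v + (\<Sum>j\<in>J. d j * (\<Sum>k\<le>N. (\<rho> j * v) ^ Suc k)) \<le> real (Suc (n + N))"
proof -
  let ?A = "a (Suc (n + N))" and ?u = "a n / a (Suc n)"
  have ak: "v ^ Suc k * ?A \<le> a (n + N - k)" if "k \<le> N" for k
  proof -
    have "v ^ Suc k * ?A \<le> ?u ^ Suc k * ?A"
      using v a(1)[of "Suc (n + N)"] by (intro mult_right_mono power_mono) auto
    also have "\<dots> \<le> a (n + N - k)"
      using log_concave_ge_power[OF a, of "Suc k" N n] that by simp
    finally show ?thesis .
  qed
  have "(\<Sum>k\<le>N. (\<rho> j * v) ^ Suc k) * ?A \<le> (\<Sum>k\<le>n + N. \<rho> j ^ Suc k * a (n + N - k))" if j: "j \<in> J" for j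
  proof -
    have "(\<Sum>k\<le>N. (\<rho> j * v) ^ Suc k) * ?A = (\<Sum>k\<le>N. \<rho> j ^ Suc k * (v ^ Suc k * ?A))"
      by (simp only: sum_distrib_right power_mult_distrib mult.assoc)
    also have "\<dots> \<le> (\<Sum>k\<le>N. \<rho> j ^ Suc k * a (n + N - k))"
      using \<rho>[OF j] ak by (intro sum_mono mult_left_mono) auto
    also have "\<dots> \<le> (\<Sum>k\<le>n + N. \<rho> j ^ Suc k * a (n + N - k))"
      using \<rho>[OF j] a(1) by (intro sum_mono2) (auto intro!: mult_nonneg_nonneg less_imp_le)
    finally show ?thesis .
  qed
  then have "(\<Sum>j\<in>J. d j * ((\<Sum>k\<le>N. (\<rho> j * v) ^ Suc k) * ?A)) \<le>
      (\<Sum>j\<in>J. d j * (\<Sum>k\<le>n + N. \<rho> j ^ Suc k * a (n + N - k)))"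
    using d by (intro sum_mono mult_left_mono) auto
  moreover have "c * (v * ?A) \<le> c * a (n + N)"
    using ak[of 0] c by (intro mult_left_mono) auto
  ultimately have "(c * v + (\<Sum>j\<in>J. d j * (\<Sum>k\<le>N. (\<rho> j * v) ^ Suc k))) * ?A \<le> real (Suc (n + N)) * ?A"
    unfolding bal distrib_right sum_distrib_right[of _ J] mult.assoc by (rule add_mono[rotated])
  then show ?thesis using a(1)[of "Suc (n + N)"] by (simp only: mult_le_cancel_right_pos)
qed

section \<open>The mean-field equation and convergence to its root\<close>

lemma geometric_mean_strict_mono:
  fixes r v w :: real
  assumes "0 < r" "0 \<le> v" "v < w" "r * w < 1"
  shows "r * v / (1 - r * v) < r * w / (1 - r * w)"
  using assms mult_strict_left_mono[of v w r] by (intro frac_less) auto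

text \<open>All summands are nondecreasing, and one with a positive coefficient grows strictly.
  Besides locating the ratio below the root, this later makes the derivative of
  \<open>aux_Lambda\<close> invertible, where the sum starts at class 2; hence the form of
  \<open>pos\<close>.\<close>

lemma mean_field_strict_mono:
  fixes \<rho> D :: "nat \<Rightarrow> real"
  assumes "finite J" and D: "\<And>j. j \<in> J \<Longrightarrow> 0 \<le> D j" and "0 \<le> C"
    and pos: "0 < C \<or> (\<exists>j\<in>J. 0 < D j)"
    and \<rho>: "\<And>j. j \<in> J \<Longrightarrow> 0 < \<rho> j \<and> \<rho> j * w < 1" and v: "0 \<le> v" "v < w"
  shows "C * v + (\<Sum>j\<in>J. D j * (\<rho> j * v / (1 - \<rho> j * v))) < C * w + (\<Sum>j\<in>J. D j * (\<rho> j * w / (1 - \<rho> j * w)))"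
proof -
  have lt: "\<rho> j * v / (1 - \<rho> j * v) < \<rho> j * w / (1 - \<rho> j * w)" if "j \<in> J" for j
    using \<rho>[OF that] v by (intro geometric_mean_strict_mono) auto
  have le: "D j * (\<rho> j * v / (1 - \<rho> j * v)) \<le> D j * (\<rho> j * w / (1 - \<rho> j * w))" if "j \<in> J" for j
    using lt[OF that] D[OF that] by (intro mult_left_mono) auto
  show ?thesis
  proof (cases "0 < C")
    case True
    then show ?thesis using v by (intro add_less_le_mono sum_mono le) auto
  next
    case False
    with pos obtain j where j: "j \<in> J" "0 < D j" by auto
    have "D j * (\<rho> j * v / (1 - \<rho> j * v)) < D j * (\<rho> j * w / (1 - \<rho> j * w))"
      using lt j by (intro mult_strict_left_mono) auto
    then have "(\<Sum>j\<in>J. D j * (\<rho> j * v / (1 - \<rho> j * v))) < (\<Sum>j\<in>J. D j * (\<rho> j * w / (1 - \<rho> j * w)))"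
      using \<open>finite J\<close> le j(1) by (intro sum_strict_mono_ex1) blast+
    moreover have "C * v \<le> C * w" using \<open>0 \<le> C\<close> v by (intro mult_left_mono) auto
    ultimately show ?thesis by linarith
  qed
qed

text \<open>
  In \<open>upper\<close> the geometric series is truncated, because the lower estimate of \<open>a\<^bsub>n-k\<^esub> / a\<^sub>n\<close> by powers of
  one ratio holds only for boundedly many \<open>k\<close>; \<open>N\<close> tends to infinity after \<open>m\<close>.
\<close>

lemma tendsto_mean_field_root:
  fixes u c e :: "nat \<Rightarrow> real" and \<rho> D :: "nat \<Rightarrow> real" and d :: "nat \<Rightarrow> nat \<Rightarrow> real"
  assumes J: "finite J" "j0 \<in> J" "0 < D j0" and D: "\<And>j. j \<in> J \<Longrightarrow> 0 \<le> D j"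
    and \<rho>: "\<And>j. j \<in> J \<Longrightarrow> 0 < \<rho> j \<and> \<rho> j \<le> 1" and "0 \<le> C"
    and q: "0 < q" "q < 1" "C * q + (\<Sum>j\<in>J. D j * (\<rho> j * q / (1 - \<rho> j * q))) = 1"
    and lim: "c \<longlonglongrightarrow> C" "\<And>j. j \<in> J \<Longrightarrow> (\<lambda>m. d m j) \<longlonglongrightarrow> D j" "e \<longlonglongrightarrow> 1"
      "\<And>N. (\<lambda>m. e' m N) \<longlonglongrightarrow> 1"
    and lower: "\<And>v. v < 1 \<Longrightarrow> eventually (\<lambda>m. u m \<le> v \<longrightarrow>
      e m \<le> c m * v + (\<Sum>j\<in>J. d m j * (\<rho> j * v / (1 - \<rho> j * v)))) sequentially"
    and upper: "\<And>v N. 0 \<le> v \<Longrightarrow> eventually (\<lambda>m. v \<le> u m \<longrightarrow>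
      c m * v + (\<Sum>j\<in>J. d m j * (\<Sum>k\<le>N. (\<rho> j * v) ^ Suc k)) \<le> e' m N) sequentially"
  shows "u \<longlonglongrightarrow> q"
proof (rule order_tendstoI)
  fix a assume "a < q"
  \<comment> \<open>Monotonicity of the mean-field function is available for nonnegative arguments,
    while \<open>a\<close> may be negative.\<close>
  define v where "v = max a 0"
  have v: "0 \<le> v" "v < q" "a \<le> v" using \<open>a < q\<close> q by (auto simp: v_def)
  let ?F = "\<lambda>m. c m * v + (\<Sum>j\<in>J. d m j * (\<rho> j * v / (1 - \<rho> j * v)))"
  have "(\<lambda>m. ?F m - e m) \<longlonglongrightarrow> (C * v + (\<Sum>j\<in>J. D j * (\<rho> j * v / (1 - \<rho> j * v)))) - 1"
    by (intro tendsto_intros lim)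
  moreover have "(C * v + (\<Sum>j\<in>J. D j * (\<rho> j * v / (1 - \<rho> j * v)))) - 1 < 0"
    using mean_field_strict_mono[of J D C \<rho> q v] J D \<open>0 \<le> C\<close> v q \<rho> mult_lt_one[OF \<rho> q(2)] by auto
  ultimately have "eventually (\<lambda>m. ?F m - e m < 0) sequentially"
    by (rule order_tendstoD)
  moreover have "eventually (\<lambda>m. u m \<le> v \<longrightarrow> e m \<le> ?F m) sequentially"
    using v q by (intro lower) simp
  ultimately show "eventually (\<lambda>m. a < u m) sequentially"
    by eventually_elim (use v in force)
next
  fix b assume "q < b"
  \<comment> \<open>Since \<open>b\<close> may exceed 1, where the full series can diverge, the
    comparison at \<open>b\<close> uses partial sums.\<close>
  let ?s = "\<lambda>v N. C * v + (\<Sum>j\<in>J. D j * (\<Sum>k\<le>N. (\<rho> j * v) ^ Suc k))"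
  have rq: "0 \<le> \<rho> j * q" "\<rho> j * q < 1" if "j \<in> J" for j
    using \<rho>[OF that] q(1) mult_lt_one[OF \<rho>[OF that] q(2)] by simp_all
  \<comment> \<open>Passing from \<open>q\<close> to \<open>b\<close>, the linear term of class
    \<open>j0\<close> alone raises the partial sum by this amount, whatever \<open>N\<close> is.
    Choosing \<open>N\<close> with a smaller truncation error at \<open>q\<close> keeps the value at
    \<open>b\<close> above 1.\<close>
  have gap: "0 < D j0 * \<rho> j0 * (b - q)" using J \<rho> \<open>q < b\<close> by simp
  have "?s q \<longlonglongrightarrow> C * q + (\<Sum>j\<in>J. D j * (\<rho> j * q / (1 - \<rho> j * q)))"
    by (intro tendsto_intros sum_geometric_Suc_tendsto rq)
  then have "eventually (\<lambda>N. 1 - D j0 * \<rho> j0 * (b - q) < ?s q N) sequentially"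
    unfolding q(3) by (rule order_tendstoD) (use gap in simp)
  then obtain N where N: "1 - D j0 * \<rho> j0 * (b - q) < ?s q N"
    by (auto simp: eventually_sequentially)
  have le: "(\<Sum>k\<le>N. (\<rho> j * q) ^ Suc k) \<le> (\<Sum>k\<le>N. (\<rho> j * b) ^ Suc k)" if "j \<in> J" for j
    using \<rho>[OF that] q \<open>q < b\<close> by (intro sum_mono power_mono mult_left_mono mult_nonneg_nonneg) auto
  have le0: "(\<Sum>k\<le>N. (\<rho> j0 * q) ^ Suc k) + \<rho> j0 * (b - q) \<le> (\<Sum>k\<le>N. (\<rho> j0 * b) ^ Suc k)"
  proof -
    have "(\<Sum>k<N. (\<rho> j0 * q) ^ Suc (Suc k)) \<le> (\<Sum>k<N. (\<rho> j0 * b) ^ Suc (Suc k))"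
      using \<rho>[OF J(2)] q \<open>q < b\<close> by (intro sum_mono power_mono mult_left_mono mult_nonneg_nonneg) auto
    then show ?thesis by (simp add: sum.atMost_shift algebra_simps)
  qed
  have "?s q N + D j0 * \<rho> j0 * (b - q) \<le> ?s b N"
  proof -
    have "D j0 * (\<Sum>k\<le>N. (\<rho> j0 * q) ^ Suc k) + D j0 * \<rho> j0 * (b - q) \<le> D j0 * (\<Sum>k\<le>N. (\<rho> j0 * b) ^ Suc k)"
      using mult_left_mono[OF le0, of "D j0"] J(3) by (simp add: algebra_simps)
    moreover have "(\<Sum>j\<in>J - {j0}. D j * (\<Sum>k\<le>N. (\<rho> j * q) ^ Suc k)) \<le> (\<Sum>j\<in>J - {j0}. D j * (\<Sum>k\<le>N. (\<rho> j * b) ^ Suc k))"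
      by (rule sum_mono, rule mult_left_mono[OF le]) (auto intro: D)
    moreover have "C * q \<le> C * b" using \<open>0 \<le> C\<close> \<open>q < b\<close> by (intro mult_left_mono) auto
    ultimately show ?thesis unfolding sum.remove[OF J(1,2)] by linarith
  qed
  then have "1 < ?s b N" using N by linarith
  let ?F = "\<lambda>m. c m * b + (\<Sum>j\<in>J. d m j * (\<Sum>k\<le>N. (\<rho> j * b) ^ Suc k))"
  have "(\<lambda>m. ?F m - e' m N) \<longlonglongrightarrow> ?s b N - 1"
    by (intro tendsto_intros lim)
  then have "eventually (\<lambda>m. 0 < ?F m - e' m N) sequentially"
    by (rule order_tendstoD) (use \<open>1 < ?s b N\<close> in simp)
  moreover have "eventually (\<lambda>m. b \<le> u m \<longrightarrow> ?F m \<le> e' m N) sequentially"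
    using q \<open>q < b\<close> by (intro upper) simp
  ultimately show "eventually (\<lambda>m. u m < b) sequentially"
    by eventually_elim force
qed

section \<open>Asymptotics of a filament system\<close>

text \<open>Regroups the terms so that \<open>k\<close> occurs only in \<open>k / x\<close>. With
  \<open>k = \<kappa> m 1\<close> and \<open>x = m\<close> this is the quotient that
  converges.\<close>

lemma scaled_second_moment:
  fixes x k A B c :: real
  shows "1 / x\<^sup>2 * (k\<^sup>2 * A) + (1 / x\<^sup>2 - 2 * c / x) * (k * B) + c\<^sup>2 =
    (k / x)\<^sup>2 * A + k / x * B * (1 / x) - 2 * c * (k / x * B) + c\<^sup>2"
proof -
  have "1 / x\<^sup>2 * (k\<^sup>2 * A) = (k / x)\<^sup>2 * A" by (simp add: power_divide)
  moreover have "(1 / x\<^sup>2 - 2 * c / x) * (k * B) = k / x * B * (1 / x) - 2 * c * (k / x * B)"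
    by (simp add: left_diff_distrib power2_eq_square)
  ultimately show ?thesis by linarith
qed

context filament_system
begin

section \<open>Class ratios and means of the auxiliary variables\<close>

lemma \<kappa>_all_pos:
  assumes "1 \<le> m" "i \<in> {1..f m}"
  shows "0 < \<kappa> m i"
  using mono_onD[OF \<kappa>_mono[OF assms(1)], of 1 i] \<kappa>_pos[OF assms(1)] assms(2) by auto

lemma \<rho>_1: "\<rho> 1 = 1"
  using ratio[of 1 1] \<kappa>1_eq[of 1] \<kappa>_pos[of 1] K_pos by simp

lemma \<kappa>\<^sub>c_pos:
  assumes "1 \<le> m" "j \<in> {1..K}"
  shows "0 < \<kappa>\<^sub>c m j"
  using strict_mono_on_leD[OF \<kappa>\<^sub>c_mono[OF assms(1)], of 1 j] \<kappa>1_eq[OF assms(1)]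
    \<kappa>_pos[OF assms(1)] assms(2) by auto

lemma \<rho>_bounds:
  assumes "j \<in> {1..K}"
  shows "0 < \<rho> j \<and> \<rho> j \<le> 1"
  using strict_mono_on_leD[OF \<kappa>\<^sub>c_mono[of 1], of 1 j] \<kappa>\<^sub>c_pos[of 1 j] \<kappa>\<^sub>c_pos[of 1 1] assms K_pos
  by (auto simp flip: ratio[of 1 j])

lemma \<rho>_less_1:
  assumes "j \<in> {2..K}"
  shows "0 < \<rho> j" "\<rho> j < 1"
proof -
  have "\<kappa>\<^sub>c 1 1 < \<kappa>\<^sub>c 1 j"
    using strict_mono_onD[OF \<kappa>\<^sub>c_mono[of 1], of 1 j] assms by auto
  then show "0 < \<rho> j" "\<rho> j < 1"
    using \<kappa>\<^sub>c_pos[of 1 j] \<rho>_bounds[of j] assms by (auto simp flip: ratio[of 1 j])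
qed

lemma ratio_eq:
  assumes "1 \<le> m" "j \<in> {1..K}"
  shows "\<kappa> m 1 / \<kappa>\<^sub>c m j = \<rho> j"
  using ratio[OF assms] \<kappa>1_eq[OF assms(1)] by simp

lemma sum_all_classes:
  fixes g :: "real \<Rightarrow> real"
  assumes "1 \<le> m"
  shows "(\<Sum>i=1..f m. g (\<kappa> m i)) = (\<Sum>j=1..K. real (class_size (\<kappa> m) (f m) (\<kappa>\<^sub>c m j)) * g (\<kappa>\<^sub>c m j))"
proof -
  have "(\<Sum>i=1..f m. g (\<kappa> m i)) = (\<Sum>x\<in>\<kappa>\<^sub>c m ` {1..K}. \<Sum>i | i \<in> {1..f m} \<and> \<kappa> m i = x. g (\<kappa> m i))"
    by (rule sum.group[symmetric]) (use \<kappa>_class[OF assms] in auto)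
  also have "\<dots> = (\<Sum>x\<in>\<kappa>\<^sub>c m ` {1..K}. real (class_size (\<kappa> m) (f m) x) * g x)"
    by (intro sum.cong refl) (simp add: class_size_def)
  also have "\<dots> = (\<Sum>j=1..K. real (class_size (\<kappa> m) (f m) (\<kappa>\<^sub>c m j)) * g (\<kappa>\<^sub>c m j))"
    by (subst sum.reindex[OF strict_mono_on_imp_inj_on[OF \<kappa>\<^sub>c_mono[OF assms]]]) simp
  finally show ?thesis .
qed

lemma expectation_aux_M:
  assumes "1 \<le> m"
  shows "measure_pmf.expectation (aux_pmf (\<kappa> m) (f m)) aux_M = \<kappa> m 1"
  using \<kappa>_pos[OF assms] by (simp add: aux_pmf_def aux_M_def[abs_def] poisson_mean)

lemma expectation_aux_S:
  assumes m: "1 \<le> m"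
  shows "measure_pmf.expectation (aux_pmf (\<kappa> m) (f m)) (aux_S (\<kappa> m) (f m)) =
    (\<Sum>j=2..K. real (class_size (\<kappa> m) (f m) (\<kappa>\<^sub>c m j)) * (\<rho> j / (1 - \<rho> j)))"
proof -
  let ?A = "{class_size (\<kappa> m) (f m) (\<kappa> m 1)<..f m}"
  let ?P = "Pi_pmf ?A 0 (\<lambda>i. geometric_pmf (1 - \<kappa> m 1 / \<kappa> m i))"
  have p: "1 - \<kappa> m 1 / \<kappa> m i \<in> {0<..1}" if "i \<in> ?A" for i
    using that \<kappa>_pos[OF m] unfolding above_min_iff[OF m] by auto
  have "measure_pmf.expectation (aux_pmf (\<kappa> m) (f m)) (aux_S (\<kappa> m) (f m)) =
      measure_pmf.expectation (map_pmf snd (aux_pmf (\<kappa> m) (f m))) (\<lambda>l. \<Sum>i\<in>?A. real (l i))"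
    by (simp add: aux_S_def[abs_def])
  also have "\<dots> = measure_pmf.expectation ?P (\<lambda>l. \<Sum>i\<in>?A. real (l i))"
    by (simp add: aux_pmf_def map_snd_pair_pmf)
  also have "\<dots> = (\<Sum>i\<in>?A. measure_pmf.expectation (geometric_pmf (1 - \<kappa> m 1 / \<kappa> m i)) real)"
    using p by (intro expectation_sum_Pi_pmf integrable_real_geometric_pmf) auto
  also have "\<dots> = (\<Sum>i\<in>?A. \<kappa> m 1 / \<kappa> m i / (1 - \<kappa> m 1 / \<kappa> m i))"
    using p by (intro sum.cong refl) (subst expectation_geometric_pmf, auto)
  also have "\<dots> = (\<Sum>j=2..K. real (class_size (\<kappa> m) (f m) (\<kappa>\<^sub>c m j)) *
      (\<kappa> m 1 / \<kappa>\<^sub>c m j / (1 - \<kappa> m 1 / \<kappa>\<^sub>c m j)))"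
    by (rule sum_classes[OF m, of "\<lambda>x. \<kappa> m 1 / x / (1 - \<kappa> m 1 / x)"])
  also have "\<dots> = (\<Sum>j=2..K. real (class_size (\<kappa> m) (f m) (\<kappa>\<^sub>c m j)) * (\<rho> j / (1 - \<rho> j)))"
  proof (intro sum.cong refl)
    fix j assume "j \<in> {2..K}"
    then have "\<kappa> m 1 / \<kappa>\<^sub>c m j = \<rho> j" by (intro ratio_eq m) auto
    then show "real (class_size (\<kappa> m) (f m) (\<kappa>\<^sub>c m j)) * (\<kappa> m 1 / \<kappa>\<^sub>c m j / (1 - \<kappa> m 1 / \<kappa>\<^sub>c m j)) =
        real (class_size (\<kappa> m) (f m) (\<kappa>\<^sub>c m j)) * (\<rho> j / (1 - \<rho> j))" by (simp only:)
  qed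
  finally show ?thesis .
qed

text \<open>\<open>scaled_partition m n\<close> is the coefficient \<open>a\<^sub>n\<close>: the rates belong to \<open>m\<close>, the size is \<open>n\<close>.\<close>

definition scaled_partition :: "nat \<Rightarrow> nat \<Rightarrow> real" where
  "scaled_partition m n = \<kappa> m 1 ^ n * partition_fun (\<kappa> m) (f m) n"

lemma scaled_partition_pos: "1 \<le> m \<Longrightarrow> 0 < scaled_partition m n"
  unfolding scaled_partition_def
  by (intro mult_pos_pos partition_fun_pos zero_less_power \<kappa>_all_pos \<kappa>_pos)

lemma scaled_partition_log_concave:
  assumes "1 \<le> m"
  shows "scaled_partition m n * scaled_partition m (n + 2) \<le> scaled_partition m (n + 1) ^ 2"
proof -
  let ?Z = "partition_fun (\<kappa> m) (f m)"
  have "scaled_partition m n * scaled_partition m (n + 2) = \<kappa> m 1 ^ n * \<kappa> m 1 ^ (n + 2) * (?Z n * ?Z (n + 2))"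
    by (simp add: scaled_partition_def)
  also have "\<dots> \<le> \<kappa> m 1 ^ n * \<kappa> m 1 ^ (n + 2) * ?Z (n + 1) ^ 2"
  proof (rule mult_left_mono)
    show "?Z n * ?Z (n + 2) \<le> ?Z (n + 1) ^ 2"
      by (rule partition_fun_log_concave) (rule \<kappa>_all_pos[OF assms])
    show "0 \<le> \<kappa> m 1 ^ n * \<kappa> m 1 ^ (n + 2)"
      using \<kappa>_pos[OF assms] by simp
  qed
  also have "\<kappa> m 1 ^ n * \<kappa> m 1 ^ (n + 2) = (\<kappa> m 1 ^ (n + 1))\<^sup>2"
    by (simp add: power2_eq_square)
  finally show ?thesis by (simp only: scaled_partition_def power_mult_distrib)
qed

text \<open>The power of \<open>\<kappa> m 1\<close> turns inverse rates into ratios independent of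
  \<open>m\<close>, and filaments with equal ratio are collected by class.\<close>

lemma scaled_partition_mass_balance:
  assumes m: "1 \<le> m"
  shows "real (Suc n) * scaled_partition m (Suc n) = \<kappa> m 1 * scaled_partition m n +
    (\<Sum>j=1..K. real (class_size (\<kappa> m) (f m) (\<kappa>\<^sub>c m j)) *
      (\<Sum>k\<le>n. \<rho> j ^ Suc k * scaled_partition m (n - k)))"
proof -
  let ?Z = "partition_fun (\<kappa> m) (f m)"
  have t: "\<kappa> m 1 ^ Suc n * (inverse x ^ Suc k * ?Z (n - k)) = (\<kappa> m 1 / x) ^ Suc k * scaled_partition m (n - k)"
    if "k \<le> n" for k x
  proof -
    have "\<kappa> m 1 ^ Suc n = \<kappa> m 1 ^ Suc k * \<kappa> m 1 ^ (n - k)"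
      using that by (simp flip: power_add)
    then show ?thesis
      unfolding scaled_partition_def divide_inverse power_mult_distrib by (simp only: mult_ac)
  qed
  have "real (Suc n) * scaled_partition m (Suc n) = \<kappa> m 1 ^ Suc n * (real (Suc n) * ?Z (Suc n))"
    by (simp add: scaled_partition_def)
  also have "\<dots> = \<kappa> m 1 ^ Suc n * ?Z n +
      (\<Sum>i=1..f m. \<Sum>k\<le>n. \<kappa> m 1 ^ Suc n * (inverse (\<kappa> m i) ^ Suc k * ?Z (n - k)))"
    unfolding partition_fun_mass_balance by (simp only: distrib_left sum_distrib_left)
  also have "\<kappa> m 1 ^ Suc n * ?Z n = \<kappa> m 1 * scaled_partition m n"
    by (simp add: scaled_partition_def)
  also have "(\<Sum>i=1..f m. \<Sum>k\<le>n. \<kappa> m 1 ^ Suc n * (inverse (\<kappa> m i) ^ Suc k * ?Z (n - k))) =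
      (\<Sum>i=1..f m. \<Sum>k\<le>n. (\<kappa> m 1 / \<kappa> m i) ^ Suc k * scaled_partition m (n - k))"
    by (intro sum.cong refl t) simp
  also have "\<dots> = (\<Sum>j=1..K. real (class_size (\<kappa> m) (f m) (\<kappa>\<^sub>c m j)) *
      (\<Sum>k\<le>n. (\<kappa> m 1 / \<kappa>\<^sub>c m j) ^ Suc k * scaled_partition m (n - k)))"
    by (rule sum_all_classes[OF m])
  also have "\<dots> = (\<Sum>j=1..K. real (class_size (\<kappa> m) (f m) (\<kappa>\<^sub>c m j)) *
      (\<Sum>k\<le>n. \<rho> j ^ Suc k * scaled_partition m (n - k)))"
    by (intro sum.cong refl arg_cong2[of _ _ _ _ "(*)"]) (simp only: ratio_eq[OF m])
  finally show ?thesis .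
qed

section \<open>Tails and factorial moments as quotients of \<open>scaled_partition\<close>\<close>

lemma prob_filament_ge:
  assumes m: "1 \<le> m" and i: "i \<in> {1..f m}" and j: "j \<in> {1..K}" "\<kappa> m i = \<kappa>\<^sub>c m j" and "k \<le> m"
  shows "measure_pmf.prob (stationary_pmf (\<kappa> m) m (f m)) {L. L i \<ge> k} =
    \<rho> j ^ k * (scaled_partition m (m - k) / scaled_partition m m)"
proof -
  let ?Z = "partition_fun (\<kappa> m) (f m)"
  have "measure_pmf.prob (stationary_pmf (\<kappa> m) m (f m)) {L. L i \<ge> k} = inverse (\<kappa> m i) ^ k * ?Z (m - k) / ?Z m"
    by (subst prob_stationary) (auto simp: sum_state_weight_ge[OF i \<open>k \<le> m\<close>] intro: \<kappa>_all_pos[OF m])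
  moreover have "\<rho> j = \<kappa> m 1 / \<kappa> m i" using ratio[OF m j(1)] \<kappa>1_eq[OF m] j(2) by simp
  moreover have "\<kappa> m 1 ^ m = \<kappa> m 1 ^ k * \<kappa> m 1 ^ (m - k)" using \<open>k \<le> m\<close> by (simp flip: power_add)
  ultimately show ?thesis
    using \<kappa>_pos[OF m] unfolding scaled_partition_def divide_inverse power_mult_distrib
    by (simp add: field_simps)
qed

lemma expectation_free_monomers:
  assumes m: "1 \<le> m"
  shows "measure_pmf.expectation (stationary_pmf (\<kappa> m) m (f m)) (free_monomers m (f m)) =
    \<kappa> m 1 * (scaled_partition m (m - 1) / scaled_partition m m)"
proof -
  obtain n where n: "m = Suc n" using m by (cases m) auto
  have "measure_pmf.expectation (stationary_pmf (\<kappa> m) m (f m)) (free_monomers m (f m)) =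
      partition_fun (\<kappa> m) (f m) n / partition_fun (\<kappa> m) (f m) m"
    using sum_free_monomers[of n "f m" "\<lambda>_. 1" "\<kappa> m"]
    by (subst expectation_stationary) (auto simp: n partition_fun_def intro: \<kappa>_all_pos[OF m, unfolded n])
  then show ?thesis using \<kappa>_pos[OF m] by (simp add: scaled_partition_def n field_simps)
qed

text \<open>Two removals of a free monomer: \<open>M - 1\<close> is the number of free monomers in
  the system of size \<open>m - 1\<close>.\<close>

lemma expectation_free_monomers_pair:
  assumes m: "2 \<le> m"
  shows "measure_pmf.expectation (stationary_pmf (\<kappa> m) m (f m))
      (\<lambda>L. free_monomers m (f m) L * (free_monomers m (f m) L - 1)) =
    \<kappa> m 1 ^ 2 * (scaled_partition m (m - 2) / scaled_partition m m)"
proof -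
  have m1: "1 \<le> m" using m by simp
  obtain n where n: "m = Suc (Suc n)" using m by (auto simp: numeral_2_eq_2 dest!: le_Suc_ex)
  have M: "free_monomers m (f m) L - 1 = free_monomers (Suc n) (f m) L" for L
    by (simp add: free_monomers_def n)
  have "measure_pmf.expectation (stationary_pmf (\<kappa> m) m (f m))
      (\<lambda>L. free_monomers m (f m) L * (free_monomers m (f m) L - 1)) =
      partition_fun (\<kappa> m) (f m) n / partition_fun (\<kappa> m) (f m) m"
    unfolding M
    using sum_free_monomers[of "Suc n" "f m" "free_monomers (Suc n) (f m)" "\<kappa> m"]
      sum_free_monomers[of n "f m" "\<lambda>_. 1" "\<kappa> m"]
    by (subst expectation_stationary) (auto simp: n partition_fun_def intro: \<kappa>_all_pos[OF m1, unfolded n])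
  then show ?thesis
    using \<kappa>_pos[OF m1] by (simp add: scaled_partition_def n field_simps power2_eq_square)
qed

section \<open>Limits, given a solution \<open>q\<close> of the mean-field equation\<close>

context
  fixes fbar :: "nat \<Rightarrow> real" and \<kappa>bar q :: real
  assumes fbar: "\<And>j. j \<in> {1..K} \<Longrightarrow>
      (\<lambda>m. real (class_size (\<kappa> m) (f m) (\<kappa>\<^sub>c m j)) / real m) \<longlonglongrightarrow> fbar j"
    and fbar_1: "0 < fbar 1" and fbar_nonneg: "\<And>j. j \<in> {1..K} \<Longrightarrow> 0 \<le> fbar j"
    and \<kappa>bar: "(\<lambda>m. \<kappa> m 1 / real m) \<longlonglongrightarrow> \<kappa>bar" "0 \<le> \<kappa>bar"
    and q: "0 < q" "q < 1" "\<kappa>bar * q + (\<Sum>j=1..K. fbar j * (\<rho> j * q / (1 - \<rho> j * q))) = 1"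
begin

text \<open>The rates stay those of \<open>m\<close> while the size is \<open>m - s\<close>. The two
  balance bounds have the totals \<open>m - s\<close> and \<open>m - s + N\<close>, both asymptotic
  to \<open>m\<close>, so every fixed \<open>s\<close> leads to the same root.\<close>

lemma scaled_partition_ratio_step:
  "(\<lambda>m. scaled_partition m (m - Suc s) / scaled_partition m (m - s)) \<longlonglongrightarrow> q"
proof (rule tendsto_mean_field_root[where J = "{1..K}" and ?j0.0 = 1 and D = fbar and \<rho> = \<rho> and C = \<kappa>bar
      and c = "\<lambda>m. \<kappa> m 1 / real m" and d = "\<lambda>m j. real (class_size (\<kappa> m) (f m) (\<kappa>\<^sub>c m j)) / real m"
      and e = "\<lambda>m. (real m - real s) / real m" and e' = "\<lambda>m N. (real m - real s + real N) / real m"])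
  let ?n = "\<lambda>m j. real (class_size (\<kappa> m) (f m) (\<kappa>\<^sub>c m j))"
  show "(\<lambda>m. (real m - real s) / real m) \<longlonglongrightarrow> 1"
    "(\<lambda>m. (real m - real s + real N) / real m) \<longlonglongrightarrow> 1" for N
    by real_asymp+
  show "\<forall>\<^sub>F m in sequentially. scaled_partition m (m - Suc s) / scaled_partition m (m - s) \<le> v \<longrightarrow>
      (real m - real s) / real m \<le> \<kappa> m 1 / real m * v + (\<Sum>j=1..K. ?n m j / real m * (\<rho> j * v / (1 - \<rho> j * v)))"
    if v: "v < 1" for v
    using eventually_ge_at_top[of "Suc s"]
  proof eventually_elim
    case (elim m)
    then have m: "1 \<le> m" and n: "Suc (m - Suc s) = m - s" by auto
    show ?case
    proof
      assume "scaled_partition m (m - Suc s) / scaled_partition m (m - s) \<le> v"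
      then have "real (m - s) \<le> \<kappa> m 1 * v + (\<Sum>j=1..K. ?n m j * (\<rho> j * v / (1 - \<rho> j * v)))"
        using ratio_lower_balance[of "scaled_partition m", OF scaled_partition_pos[OF m]
            scaled_partition_log_concave[OF m] scaled_partition_mass_balance[OF m], of "m - Suc s" v]
          \<kappa>_pos[OF m] \<rho>_bounds v by (simp add: n)
      then have "real (m - s) / real m \<le> (\<kappa> m 1 * v + (\<Sum>j=1..K. ?n m j * (\<rho> j * v / (1 - \<rho> j * v)))) / real m"
        by (rule divide_right_mono) simp
      then show "(real m - real s) / real m \<le> \<kappa> m 1 / real m * v + (\<Sum>j=1..K. ?n m j / real m * (\<rho> j * v / (1 - \<rho> j * v)))"
        using elim by (simp add: add_divide_distrib sum_divide_distrib of_nat_diff mult.commute)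
    qed
  qed
  show "\<forall>\<^sub>F m in sequentially. v \<le> scaled_partition m (m - Suc s) / scaled_partition m (m - s) \<longrightarrow>
      \<kappa> m 1 / real m * v + (\<Sum>j=1..K. ?n m j / real m * (\<Sum>k\<le>N. (\<rho> j * v) ^ Suc k)) \<le>
      (real m - real s + real N) / real m"
    if v: "0 \<le> v" for v N
    using eventually_ge_at_top[of "Suc s"]
  proof eventually_elim
    case (elim m)
    then have m: "1 \<le> m" and n: "Suc (m - Suc s) = m - s" by auto
    show ?case
    proof
      assume "v \<le> scaled_partition m (m - Suc s) / scaled_partition m (m - s)"
      then have "\<kappa> m 1 * v + (\<Sum>j=1..K. ?n m j * (\<Sum>k\<le>N. (\<rho> j * v) ^ Suc k)) \<le> real (Suc (m - Suc s + N))"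
        using \<kappa>_pos[OF m] \<rho>_bounds v
        by (intro ratio_upper_balance[of "scaled_partition m", OF scaled_partition_pos[OF m]
            scaled_partition_log_concave[OF m] scaled_partition_mass_balance[OF m]]) (auto simp: n)
      then have "(\<kappa> m 1 * v + (\<Sum>j=1..K. ?n m j * (\<Sum>k\<le>N. (\<rho> j * v) ^ Suc k))) / real m \<le> real (Suc (m - Suc s + N)) / real m"
        by (rule divide_right_mono) simp
      also have "real (Suc (m - Suc s + N)) = real m - real s + real N" using elim by simp
      also have "(\<kappa> m 1 * v + (\<Sum>j=1..K. ?n m j * (\<Sum>k\<le>N. (\<rho> j * v) ^ Suc k))) / real m =
          \<kappa> m 1 / real m * v + (\<Sum>j=1..K. ?n m j / real m * (\<Sum>k\<le>N. (\<rho> j * v) ^ Suc k))"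
        by (simp add: add_divide_distrib sum_divide_distrib)
      finally show "\<kappa> m 1 / real m * v + (\<Sum>j=1..K. ?n m j / real m * (\<Sum>k\<le>N. (\<rho> j * v) ^ Suc k)) \<le>
          (real m - real s + real N) / real m" .
    qed
  qed
qed (use K_pos fbar_1 fbar fbar_nonneg \<rho>_bounds \<kappa>bar q in auto)

lemma scaled_partition_ratio:
  "(\<lambda>m. scaled_partition m (m - k) / scaled_partition m m) \<longlonglongrightarrow> q ^ k"
proof (induction k)
  case 0
  show ?case
    by (rule Lim_transform_eventually[of "\<lambda>_. 1"])
       (use scaled_partition_pos in \<open>auto intro!: eventually_sequentiallyI[of 1] simp: less_imp_neq[symmetric]\<close>)
next
  case (Suc k)
  show ?case
  proof (rule Lim_transform_eventually)
    show "(\<lambda>m. scaled_partition m (m - Suc k) / scaled_partition m (m - k) *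
        (scaled_partition m (m - k) / scaled_partition m m)) \<longlonglongrightarrow> q ^ Suc k"
      using tendsto_mult[OF scaled_partition_ratio_step Suc.IH, of k] by simp
    show "\<forall>\<^sub>F m in sequentially. scaled_partition m (m - Suc k) / scaled_partition m (m - k) *
        (scaled_partition m (m - k) / scaled_partition m m) = scaled_partition m (m - Suc k) / scaled_partition m m"
      using eventually_ge_at_top[of 1]
    proof eventually_elim
      case (elim m)
      then show ?case using scaled_partition_pos[of m "m - k"] by simp
    qed
  qed
qed

lemma prob_filament_tendsto:
  assumes j: "j \<in> {1..K}" and i: "\<And>m. 1 \<le> m \<Longrightarrow> i m \<in> {1..f m} \<and> \<kappa> m (i m) = \<kappa>\<^sub>c m j"
  shows "(\<lambda>m. measure_pmf.prob (stationary_pmf (\<kappa> m) m (f m)) {L. L (i m) \<ge> l}) \<longlonglongrightarrow> (\<rho> j * q) ^ l"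
proof (rule Lim_transform_eventually)
  show "(\<lambda>m. \<rho> j ^ l * (scaled_partition m (m - l) / scaled_partition m m)) \<longlonglongrightarrow> (\<rho> j * q) ^ l"
    unfolding power_mult_distrib by (intro tendsto_intros scaled_partition_ratio)
  show "\<forall>\<^sub>F m in sequentially. \<rho> j ^ l * (scaled_partition m (m - l) / scaled_partition m m) =
      measure_pmf.prob (stationary_pmf (\<kappa> m) m (f m)) {L. L (i m) \<ge> l}"
    using eventually_ge_at_top[of "max 1 l"]
    by eventually_elim (subst prob_filament_ge, use i j in auto)
qed

text \<open>Chebyshev's inequality around the limit \<open>\<kappa>bar * q\<close> instead of the
  mean. The mean square deviation \<open>?V\<close> is computed from the first two factorial
  moments.\<close>

lemma free_monomers_tendsto_prob:
  assumes "0 < \<epsilon>"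
  shows "(\<lambda>m. measure_pmf.prob (stationary_pmf (\<kappa> m) m (f m))
    {L. \<bar>free_monomers m (f m) L / real m - \<kappa>bar * q\<bar> > \<epsilon>}) \<longlonglongrightarrow> 0"
proof -
  let ?P = "\<lambda>m. stationary_pmf (\<kappa> m) m (f m)" and ?M = "\<lambda>m. free_monomers m (f m)"
  let ?r = "\<lambda>k m. scaled_partition m (m - k) / scaled_partition m m"
  let ?V = "\<lambda>m. (\<kappa> m 1 / real m)\<^sup>2 * ?r 2 m + \<kappa> m 1 / real m * ?r 1 m * (1 / real m)
     - 2 * (\<kappa>bar * q) * (\<kappa> m 1 / real m * ?r 1 m) + (\<kappa>bar * q)\<^sup>2"
  have int: "integrable (?P m) h" if "1 \<le> m" for m and h :: "(nat \<Rightarrow> nat) \<Rightarrow> real"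
  proof (rule integrable_measure_pmf_finite, rule finite_subset)
    show "set_pmf (?P m) \<subseteq> filament_states m (f m)"
      using pmf_stationary[of "f m" "\<kappa> m" m] \<kappa>_all_pos[OF that]
      by (metis (full_types) set_pmf_iff subsetI)
  qed (rule finite_filament_states)
  have V: "measure_pmf.expectation (?P m) (\<lambda>L. (?M m L / real m - \<kappa>bar * q)\<^sup>2) = ?V m" if m: "2 \<le> m" for m
  proof -
    have m1: "1 \<le> m" using m by simp
    have "(?M m L / real m - \<kappa>bar * q)\<^sup>2 = 1 / (real m)\<^sup>2 * (?M m L * (?M m L - 1)) +
        (1 / (real m)\<^sup>2 - 2 * (\<kappa>bar * q) / real m) * ?M m L + (\<kappa>bar * q)\<^sup>2" for L
      using m by (simp add: field_simps power2_eq_square)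
    then have "measure_pmf.expectation (?P m) (\<lambda>L. (?M m L / real m - \<kappa>bar * q)\<^sup>2) =
        1 / (real m)\<^sup>2 * (\<kappa> m 1 ^ 2 * ?r 2 m) + (1 / (real m)\<^sup>2 - 2 * (\<kappa>bar * q) / real m) * (\<kappa> m 1 * ?r 1 m) + (\<kappa>bar * q)\<^sup>2"
      by (simp add: int[OF m1] expectation_free_monomers[OF m1] expectation_free_monomers_pair[OF m])
    from trans[OF this scaled_second_moment] show ?thesis .
  qed
  \<comment> \<open>With \<open>c = \<kappa>bar * q\<close> the limit is
    \<open>c^2 + 0 - 2 * c^2 + c^2\<close>, which vanishes.\<close>
  have "?V \<longlonglongrightarrow> \<kappa>bar\<^sup>2 * q ^ 2 + \<kappa>bar * q ^ 1 * 0 - 2 * (\<kappa>bar * q) * (\<kappa>bar * q ^ 1) + (\<kappa>bar * q)\<^sup>2"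
    by (intro tendsto_intros \<kappa>bar scaled_partition_ratio lim_1_over_n)
  then have "?V \<longlonglongrightarrow> 0" by (simp add: power2_eq_square)
  then have lim: "(\<lambda>m. ?V m / \<epsilon>\<^sup>2) \<longlonglongrightarrow> 0" using assms by (intro tendsto_divide_zero)
  have bound: "measure_pmf.prob (?P m) {L. \<bar>?M m L / real m - \<kappa>bar * q\<bar> > \<epsilon>} \<le> ?V m / \<epsilon>\<^sup>2" if m: "2 \<le> m" for m
  proof -
    let ?u = "\<lambda>L. (?M m L / real m - \<kappa>bar * q)\<^sup>2"
    have "measure_pmf.prob (?P m) {L. \<bar>?M m L / real m - \<kappa>bar * q\<bar> > \<epsilon>} \<le>
        measure_pmf.prob (?P m) {L \<in> space (?P m). ?u L \<ge> \<epsilon>\<^sup>2}"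
      using assms by (intro measure_pmf.finite_measure_mono) (auto simp flip: abs_le_square_iff)
    also have "\<dots> \<le> measure_pmf.expectation (?P m) ?u / \<epsilon>\<^sup>2"
      using m assms by (intro integral_Markov_inequality_measure[where A = "{}"] int) auto
    finally show ?thesis unfolding V[OF m] .
  qed
  show ?thesis
    by (rule tendsto_sandwich[OF _ _ tendsto_const lim])
       (use bound in \<open>auto intro!: eventually_sequentiallyI[of 2]\<close>)
qed

end

end

section \<open>Legendre duality\<close>

text \<open>As \<open>- h\<close> increases, \<open>G\<close> is convex on the half-line and lies
  above its tangent at \<open>\<theta>\<^sub>0\<close>; the mean value theorem supplies the tangent
  inequality on either side.\<close>

lemma legendre_maximum:
  fixes G h :: "real \<Rightarrow> real"
  assumes G: "\<And>\<theta>. 0 \<le> \<theta> \<Longrightarrow> (G has_real_derivative - h \<theta>) (at \<theta>)"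
    and h: "\<And>a b. 0 \<le> a \<Longrightarrow> a < b \<Longrightarrow> h b < h a" and "0 \<le> \<theta>" "0 \<le> \<theta>\<^sub>0"
  shows "- \<theta> * h \<theta>\<^sub>0 - G \<theta> \<le> - \<theta>\<^sub>0 * h \<theta>\<^sub>0 - G \<theta>\<^sub>0"
proof (cases \<theta> \<theta>\<^sub>0 rule: linorder_cases)
  case less
  with assms obtain z where z: "\<theta> < z" "z < \<theta>\<^sub>0" "G \<theta>\<^sub>0 - G \<theta> = (\<theta>\<^sub>0 - \<theta>) * - h z"
    using MVT2[of \<theta> \<theta>\<^sub>0 G "\<lambda>x. - h x"] by auto
  have "(\<theta>\<^sub>0 - \<theta>) * h \<theta>\<^sub>0 \<le> (\<theta>\<^sub>0 - \<theta>) * h z"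
    using h[of z \<theta>\<^sub>0] z less \<open>0 \<le> \<theta>\<close> by (intro mult_left_mono) auto
  then show ?thesis using z(3) by (simp add: algebra_simps)
next
  case greater
  with assms obtain z where z: "\<theta>\<^sub>0 < z" "z < \<theta>" "G \<theta> - G \<theta>\<^sub>0 = (\<theta> - \<theta>\<^sub>0) * - h z"
    using MVT2[of \<theta>\<^sub>0 \<theta> G "\<lambda>x. - h x"] by auto
  have "(\<theta> - \<theta>\<^sub>0) * h z \<le> (\<theta> - \<theta>\<^sub>0) * h \<theta>\<^sub>0"
    using h[of \<theta>\<^sub>0 z] z greater \<open>0 \<le> \<theta>\<^sub>0\<close> by (intro mult_left_mono) auto
  then show ?thesis using z(3) by (simp add: algebra_simps)
qed simp

text \<open>The supremum at \<open>x\<close> is attained at \<open>\<tau> x\<close>, so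
  \<open>- \<tau> x\<close> is a subgradient there. Tangents at \<open>x\<close> and
  \<open>x\<^sub>0\<close> enclose the difference quotient between \<open>- \<tau> x\<close> and
  \<open>- \<tau> x\<^sub>0\<close>, and continuity of the inverse \<open>\<tau>\<close> closes the
  gap.\<close>

lemma legendre_derivative:
  fixes G h \<tau> :: "real \<Rightarrow> real"
  assumes G: "\<And>\<theta>. 0 \<le> \<theta> \<Longrightarrow> (G has_real_derivative - h \<theta>) (at \<theta>)"
    and h: "\<And>a b. 0 \<le> a \<Longrightarrow> a < b \<Longrightarrow> h b < h a"
    and \<tau>: "\<And>x. x \<in> {0<..<s} \<Longrightarrow> 0 \<le> \<tau> x \<and> h (\<tau> x) = x" and x\<^sub>0: "x\<^sub>0 \<in> {0<..<s}"
  shows "((\<lambda>x. SUP \<theta>\<in>{0..}. - \<theta> * x - G \<theta>) has_real_derivative - \<tau> x\<^sub>0) (at x\<^sub>0)"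
proof -
  let ?l = "\<lambda>x. SUP \<theta>\<in>{0..}. - \<theta> * x - G \<theta>"
  have l: "?l x = - \<tau> x * x - G (\<tau> x)" if "x \<in> {0<..<s}" for x
    using legendre_maximum[OF G h, of _ "\<tau> x"] \<tau>[OF that] by (intro cSup_eq_maximum) auto
  have tangent: "?l x - \<tau> x * (y - x) \<le> ?l y" if "x \<in> {0<..<s}" "y \<in> {0<..<s}" for x y
  proof -
    have "?l x - \<tau> x * (y - x) = - \<tau> x * y - G (\<tau> x)"
      unfolding l[OF that(1)] by (simp add: algebra_simps)
    also have "\<dots> \<le> ?l y"
      unfolding l[OF that(2)]
      using legendre_maximum[OF G h, of "\<tau> x" "\<tau> y"] \<tau>[OF that(1)] \<tau>[OF that(2)] by simp
    finally show ?thesis .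
  qed
  have ev: "\<forall>\<^sub>F x in at x\<^sub>0. x \<in> {0<..<s}"
    using x\<^sub>0 by (intro eventually_at_in_open') auto
  have \<tau>_lim: "(\<tau> \<longlongrightarrow> \<tau> x\<^sub>0) (at x\<^sub>0)"
  proof (rule order_tendstoI)
    fix a assume a: "a < \<tau> x\<^sub>0"
    show "\<forall>\<^sub>F x in at x\<^sub>0. a < \<tau> x"
    \<comment> \<open>Strict decrease of \<open>h\<close> is known on the half-line only; for
      negative \<open>a\<close> the sign of \<open>\<tau>\<close> decides.\<close>
    proof (cases "0 \<le> a")
      case True
      then have "x\<^sub>0 < h a" using h[OF True a] \<tau>[OF x\<^sub>0] by simp
      then have "\<forall>\<^sub>F x in at x\<^sub>0. x < h a"
        by (intro order_tendstoD(2)[OF tendsto_ident_at])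
      then show ?thesis using ev
      proof eventually_elim
        case (elim x)
        then show ?case using h[of "\<tau> x" a] \<tau>[of x] by (cases "\<tau> x" a rule: linorder_cases) auto
      qed
    next
      case False
      show ?thesis using ev by eventually_elim (use False \<tau> in force)
    qed
  next
    fix a assume a: "\<tau> x\<^sub>0 < a"
    then have "h a < x\<^sub>0" using h[OF _ a] \<tau>[OF x\<^sub>0] by simp
    then have "\<forall>\<^sub>F x in at x\<^sub>0. h a < x"
      by (intro order_tendstoD(1)[OF tendsto_ident_at])
    then show "\<forall>\<^sub>F x in at x\<^sub>0. \<tau> x < a" using ev
    proof eventually_elim
      case (elim x)
      then show ?case using h[of a "\<tau> x"] \<tau>[of x] \<tau>[OF x\<^sub>0] a
        by (cases "\<tau> x" a rule: linorder_cases) auto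
    qed
  qed
  have bound: "\<bar>(?l x - ?l x\<^sub>0) / (x - x\<^sub>0) + \<tau> x\<^sub>0\<bar> \<le> \<bar>\<tau> x - \<tau> x\<^sub>0\<bar>"
    if x: "x \<in> {0<..<s}" "x \<noteq> x\<^sub>0" for x
  proof -
    have "\<bar>?l x - ?l x\<^sub>0 + \<tau> x\<^sub>0 * (x - x\<^sub>0)\<bar> \<le> \<bar>(\<tau> x - \<tau> x\<^sub>0) * (x - x\<^sub>0)\<bar>"
      using tangent[OF x(1) x\<^sub>0] tangent[OF x\<^sub>0 x(1)] by (simp add: algebra_simps abs_le_iff)
    moreover have "(?l x - ?l x\<^sub>0) / (x - x\<^sub>0) + \<tau> x\<^sub>0 = (?l x - ?l x\<^sub>0 + \<tau> x\<^sub>0 * (x - x\<^sub>0)) / (x - x\<^sub>0)"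
      using x(2) by (simp add: add_divide_distrib)
    ultimately show ?thesis using x(2) by (simp add: abs_mult pos_divide_le_eq)
  qed
  have "((\<lambda>x. (?l x - ?l x\<^sub>0) / (x - x\<^sub>0) + \<tau> x\<^sub>0) \<longlongrightarrow> 0) (at x\<^sub>0)"
  proof (rule Lim_null_comparison)
    show "((\<lambda>x. \<bar>\<tau> x - \<tau> x\<^sub>0\<bar>) \<longlongrightarrow> 0) (at x\<^sub>0)"
      using tendsto_rabs_zero[OF LIM_zero[OF \<tau>_lim]] .
    show "\<forall>\<^sub>F x in at x\<^sub>0. norm ((?l x - ?l x\<^sub>0) / (x - x\<^sub>0) + \<tau> x\<^sub>0) \<le> \<bar>\<tau> x - \<tau> x\<^sub>0\<bar>"
      using eventually_conj[OF ev eventually_neq_at_within[of x\<^sub>0 x\<^sub>0 UNIV]]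
      by eventually_elim (use bound in \<open>auto simp: real_norm_def\<close>)
  qed
  then have "((\<lambda>x. (?l x - ?l x\<^sub>0) / (x - x\<^sub>0)) \<longlongrightarrow> - \<tau> x\<^sub>0) (at x\<^sub>0)"
    using tendsto_diff[OF _ tendsto_const[of "\<tau> x\<^sub>0"]] by fastforce
  then show ?thesis unfolding has_field_derivative_iff .
qed

lemma log_laplace_geometric_deriv:
  fixes r \<theta> :: real
  assumes "0 < r" "r < 1" "0 \<le> \<theta>"
  shows "((\<lambda>\<theta>. ln ((1 - r) / (1 - r * exp (- \<theta>)))) has_real_derivative
    - (r * exp (- \<theta>) / (1 - r * exp (- \<theta>)))) (at \<theta>)"
proof -
  have "r * exp (- \<theta>) \<le> r" using assms by (intro mult_left_le) auto
  then have lt: "r * exp (- \<theta>) < 1" using \<open>r < 1\<close> by (rule le_less_trans)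
  then have "0 < (1 - r) / (1 - r * exp (- \<theta>))" using assms by simp
  then show ?thesis using lt assms
    by (auto intro!: derivative_eq_intros simp: power2_eq_square divide_simps)
qed

text \<open>The equivalence of the two equations is stated for every \<open>x\<close> in the
  interval: at \<open>\<psi>\<close> alone it would merely compare two true statements.\<close>

theorem theorem1:
  fixes K :: nat
    and f :: "nat \<Rightarrow> nat"
    and \<kappa> \<kappa>\<^sub>c :: "nat \<Rightarrow> nat \<Rightarrow> real"
    and \<rho> fbar :: "nat \<Rightarrow> real"
    and \<kappa>bar sbar :: real
  assumes "filament_system K f \<kappa> \<kappa>\<^sub>c \<rho>"
    and "(\<lambda>m. real (class_size (\<kappa> m) (f m) (\<kappa>\<^sub>c m 1)) / real m) \<longlonglongrightarrow> fbar 1"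
    and "0 < fbar 1"
    and "\<And>j. j \<in> {2..K} \<Longrightarrow>
           (\<lambda>m. real (class_size (\<kappa> m) (f m) (\<kappa>\<^sub>c m j)) / real m) \<longlonglongrightarrow> fbar j"
    and "\<And>j. j \<in> {2..K} \<Longrightarrow> 0 \<le> fbar j"
    and "(\<lambda>m. measure_pmf.expectation (aux_pmf (\<kappa> m) (f m)) aux_M / real m) \<longlonglongrightarrow> \<kappa>bar"
    and "0 \<le> \<kappa>bar"
    and "(\<lambda>m. measure_pmf.expectation (aux_pmf (\<kappa> m) (f m)) (aux_S (\<kappa> m) (f m)) / real m)
           \<longlonglongrightarrow> sbar"
    and "0 \<le> sbar"
  shows "\<exists>\<psi>::real.
    (if \<kappa>bar + sbar = 0 then \<psi> = 0
     else \<psi> \<in> {0<..<min (\<kappa>bar + sbar) 1} \<and>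
       (aux_rate f \<kappa> has_real_derivative ln ((1 - \<psi>) / (fbar 1 + 1 - \<psi>))) (at \<psi>) \<and>
       (\<forall>x\<in>{0<..<min (\<kappa>bar + sbar) 1}.
          (aux_rate f \<kappa> has_real_derivative ln ((1 - x) / (fbar 1 + 1 - x))) (at x) \<longleftrightarrow>
          (\<exists>D. (aux_Lambda f \<kappa> has_real_derivative D) (at (- ln ((1 - x) / (fbar 1 + 1 - x)))) \<and>
               x + D = 0))) \<and>
    (\<forall>i j. j \<in> {1..K} \<and> (\<forall>m\<ge>1. i m \<in> {1..f m} \<and> \<kappa> m (i m) = \<kappa>\<^sub>c m j) \<longrightarrow>
       (\<forall>l::nat. (\<lambda>m. measure_pmf.prob (stationary_pmf (\<kappa> m) m (f m)) {L. L (i m) \<ge> l})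
          \<longlonglongrightarrow> (\<rho> j * ((1 - \<psi>) / (fbar 1 + 1 - \<psi>))) ^ l)) \<and>
    (\<forall>\<epsilon>>0. (\<lambda>m. measure_pmf.prob (stationary_pmf (\<kappa> m) m (f m))
         {L. \<bar>free_monomers m (f m) L / real m - \<kappa>bar * ((1 - \<psi>) / (fbar 1 + 1 - \<psi>))\<bar> > \<epsilon>})
       \<longlonglongrightarrow> 0)"
proof -
  interpret filament_system K f \<kappa> \<kappa>\<^sub>c \<rho> by fact
  have fbar: "(\<lambda>m. real (class_size (\<kappa> m) (f m) (\<kappa>\<^sub>c m j)) / real m) \<longlonglongrightarrow> fbar j"
    and fbar_nonneg: "0 \<le> fbar j" if "j \<in> {1..K}" for j
    using assms(2-5) that by (cases "j = 1"; auto)+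
  have \<kappa>bar: "(\<lambda>m. \<kappa> m 1 / real m) \<longlonglongrightarrow> \<kappa>bar"
    by (rule Lim_transform_eventually[OF assms(6)])
       (auto intro!: eventually_sequentiallyI[of 1] simp: expectation_aux_M)
  have "(\<lambda>m. \<Sum>j=2..K. real (class_size (\<kappa> m) (f m) (\<kappa>\<^sub>c m j)) / real m * (\<rho> j / (1 - \<rho> j)))
      \<longlonglongrightarrow> (\<Sum>j=2..K. fbar j * (\<rho> j / (1 - \<rho> j)))"
    by (intro tendsto_intros assms(4))
  then have "(\<lambda>m. measure_pmf.expectation (aux_pmf (\<kappa> m) (f m)) (aux_S (\<kappa> m) (f m)) / real m)
      \<longlonglongrightarrow> (\<Sum>j=2..K. fbar j * (\<rho> j / (1 - \<rho> j)))"
    by (rule Lim_transform_eventually)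
       (rule eventually_sequentiallyI[of 1], simp only: expectation_aux_S sum_divide_distrib times_divide_eq_left)
  then have sbar: "sbar = (\<Sum>j=2..K. fbar j * (\<rho> j / (1 - \<rho> j)))"
    using assms(8) LIMSEQ_unique by blast

  \<comment> \<open>\<open>H (exp (- \<theta>))\<close> is minus the derivative of
    \<open>aux_Lambda\<close> at \<open>\<theta>\<close>. Class 1 is left out, as its term has a
    pole at \<open>t = 1\<close>.\<close>
  define H where "H t = \<kappa>bar * t + (\<Sum>j=2..K. fbar j * (\<rho> j * t / (1 - \<rho> j * t)))" for t
  have H0: "H 0 = 0" and H1: "H 1 = \<kappa>bar + sbar" by (simp_all add: H_def sbar)
  have \<rho>t: "0 < \<rho> j \<and> \<rho> j * t < 1" if "j \<in> {2..K}" "t \<le> 1" for j t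
  proof -
    have "\<rho> j * t \<le> \<rho> j" using \<rho>_less_1[OF that(1)] that(2) by (simp add: mult_left_le)
    then show ?thesis using \<rho>_less_1[OF that(1)] by linarith
  qed
  have H_less: "H v < H w" if "\<kappa>bar + sbar \<noteq> 0" "0 \<le> v" "v < w" "w \<le> 1" for v w
  proof -
    have "0 < \<kappa>bar \<or> (\<exists>j\<in>{2..K}. 0 < fbar j)"
    proof (rule ccontr)
      assume "\<not> ?thesis"
      then have "\<kappa>bar = 0" "\<forall>j\<in>{2..K}. fbar j = 0" using assms(5,7) by force+
      then show False using \<open>\<kappa>bar + sbar \<noteq> 0\<close> by (simp add: sbar)
    qed
    then show ?thesis
      unfolding H_def using that assms(5,7) \<rho>t[of _ w] by (intro mean_field_strict_mono) auto
  qed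
  have H_nonneg: "0 \<le> H t" if "0 \<le> t" "t \<le> 1" for t
    unfolding H_def using that assms(5,7) \<rho>t[of _ t]
    by (intro add_nonneg_nonneg sum_nonneg mult_nonneg_nonneg divide_nonneg_nonneg)
       (auto intro: less_imp_le)
  have H_zero: "H t = 0" if "\<kappa>bar + sbar = 0" for t
  proof -
    have "sbar = 0" "\<kappa>bar = 0" using that assms(7,9) by auto
    have nn: "0 \<le> fbar j * (\<rho> j / (1 - \<rho> j))" if "j \<in> {2..K}" for j
      using assms(5)[OF that] \<rho>_less_1[OF that] by simp
    have "fbar j = 0" if j: "j \<in> {2..K}" for j
    proof -
      have "fbar j * (\<rho> j / (1 - \<rho> j)) = 0"
        using \<open>sbar = 0\<close> j nn unfolding sbar by (subst (asm) sum_nonneg_eq_0_iff) auto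
      then show ?thesis using \<rho>_less_1[OF j] by simp
    qed
    then show ?thesis using \<open>\<kappa>bar = 0\<close> by (simp add: H_def)
  qed
  have H_cont: "continuous_on {0..1} H"
    unfolding H_def using \<rho>t by (intro continuous_intros) (auto simp: less_le)

  obtain q where q: "0 < q" "q < 1" "fbar 1 * (q / (1 - q)) + H q = 1"
  proof -
    \<comment> \<open>At this point the class 1 term alone equals 1, because
      \<open>?b / (1 - ?b) = 1 / fbar 1\<close>; it serves as the upper end for the intermediate
      value theorem.\<close>
    let ?b = "1 / (1 + fbar 1)" and ?\<Phi> = "\<lambda>t. fbar 1 * (t / (1 - t)) + H t"
    have b: "0 < ?b" "?b < 1" using assms(3) by auto
    have "continuous_on {0..?b} ?\<Phi>"
      using b by (intro continuous_intros continuous_on_subset[OF H_cont]) auto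
    moreover have "?\<Phi> 0 \<le> 1" by (simp add: H0)
    moreover have "1 \<le> ?\<Phi> ?b"
    proof -
      have "fbar 1 * (?b / (1 - ?b)) = 1" using assms(3) by (simp add: divide_simps)
      then show ?thesis using H_nonneg[of ?b] b by simp
    qed
    ultimately obtain q where q: "0 \<le> q" "q \<le> ?b" "?\<Phi> q = 1"
      using IVT'[of ?\<Phi> 0 1 ?b] b by auto
    have "q \<noteq> 0" using q(3) by (auto simp: H0)
    then show thesis using that[of q] q b by auto
  qed
  \<comment> \<open>With this choice the equation for \<open>q\<close> reads
    \<open>1 - \<psi> = fbar 1 * (q / (1 - q))\<close>, and solving it for \<open>q\<close> gives
    the fraction in the theorem.\<close>
  define \<psi> where "\<psi> = H q"
  have \<psi>_eq: "1 - \<psi> = fbar 1 * (q / (1 - q))" using q(3) by (simp add: \<psi>_def)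
  have "0 < 1 - \<psi>" unfolding \<psi>_eq using q assms(3) by simp
  have "fbar 1 + 1 - \<psi> = fbar 1 / (1 - q)"
    using \<psi>_eq q by (simp add: field_simps)
  then have q_eq: "(1 - \<psi>) / (fbar 1 + 1 - \<psi>) = q"
    unfolding \<psi>_eq using q assms(3) by simp
  \<comment> \<open>Since \<open>\<rho> 1 = 1\<close>, the term \<open>q / (1 - q)\<close> is the
    class 1 summand of the full equation.\<close>
  have q_root: "\<kappa>bar * q + (\<Sum>j=1..K. fbar j * (\<rho> j * q / (1 - \<rho> j * q))) = 1"
    using q(3) K_pos \<rho>_1 by (simp add: H_def sum.atLeast_Suc_atMost numeral_2_eq_2)

  have rate: "\<psi> \<in> {0<..<min (\<kappa>bar + sbar) 1} \<and>
       (aux_rate f \<kappa> has_real_derivative ln ((1 - \<psi>) / (fbar 1 + 1 - \<psi>))) (at \<psi>) \<and>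
       (\<forall>x\<in>{0<..<min (\<kappa>bar + sbar) 1}.
          (aux_rate f \<kappa> has_real_derivative ln ((1 - x) / (fbar 1 + 1 - x))) (at x) \<longleftrightarrow>
          (\<exists>D. (aux_Lambda f \<kappa> has_real_derivative D) (at (- ln ((1 - x) / (fbar 1 + 1 - x)))) \<and>
               x + D = 0))"
    if ne: "\<kappa>bar + sbar \<noteq> 0"
  proof -
    have H_inj: "v = w" if "H v = H w" "0 \<le> v" "v \<le> 1" "0 \<le> w" "w \<le> 1" for v w
      using H_less[OF ne, of v w] H_less[OF ne, of w v] that by (cases v w rule: linorder_cases) auto
    \<comment> \<open>The explicit formula makes sense around 0 and so has a two-sided derivative
      there, while \<open>aux_Lambda\<close> is identified with it only for
      \<open>\<theta> \<ge> 0\<close>.\<close>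
    define G where "G \<theta> = - \<kappa>bar * (1 - exp (- \<theta>)) +
      (\<Sum>j=2..K. fbar j * ln ((1 - \<rho> j) / (1 - \<rho> j * exp (- \<theta>))))" for \<theta>
    have Lambda: "aux_Lambda f \<kappa> \<theta> = G \<theta>" if "0 \<le> \<theta>" for \<theta>
      unfolding G_def by (rule aux_Lambda_eq(2)[OF assms(4,6) that])
    have G: "(G has_real_derivative - H (exp (- \<theta>))) (at \<theta>)" if "0 \<le> \<theta>" for \<theta>
    proof -
      have "(G has_real_derivative - \<kappa>bar * (0 - - exp (- \<theta>)) +
          (\<Sum>j=2..K. fbar j * - (\<rho> j * exp (- \<theta>) / (1 - \<rho> j * exp (- \<theta>))))) (at \<theta>)"
        unfolding G_def[abs_def]
        by (intro DERIV_add DERIV_sum DERIV_cmult log_laplace_geometric_deriv \<rho>_less_1 that)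
           (auto intro!: derivative_eq_intros)
      then show ?thesis by (simp add: H_def sum_negf)
    qed
    have h: "H (exp (- b)) < H (exp (- a))" if "0 \<le> a" "a < b" for a b :: real
      using that by (intro H_less[OF ne]) auto
    have "\<exists>t. 0 < t \<and> t \<le> 1 \<and> H t = x" if x: "x \<in> {0<..<\<kappa>bar + sbar}" for x
    proof -
      have "\<exists>t. 0 \<le> t \<and> t \<le> 1 \<and> H t = x"
        using x by (intro IVT' H_cont) (auto simp: H0 H1)
      then show ?thesis using x H0 by (metis greaterThanLessThan_iff less_eq_real_def less_irrefl)
    qed
    \<comment> \<open>\<open>T\<close> inverts \<open>H\<close>, so \<open>- ln (T x)\<close> is the
      maximiser in the supremum that defines \<open>aux_rate\<close> at \<open>x\<close>.\<close>
    then obtain T where T: "0 < T x \<and> T x \<le> 1 \<and> H (T x) = x" if "x \<in> {0<..<\<kappa>bar + sbar}" for x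
      by metis
    have rate_eq: "aux_rate f \<kappa> = (\<lambda>x. SUP \<theta>\<in>{0..}. - \<theta> * x - G \<theta>)"
      unfolding aux_rate_def[abs_def] by (intro ext SUP_cong) (auto simp: Lambda)
    have deriv: "(aux_rate f \<kappa> has_real_derivative ln (T x)) (at x)" if x: "x \<in> {0<..<\<kappa>bar + sbar}" for x
    proof -
      have "0 \<le> - ln (T y) \<and> H (exp (- (- ln (T y)))) = y" if "y \<in> {0<..<\<kappa>bar + sbar}" for y
        using T[OF that] by simp
      from legendre_derivative[of G "\<lambda>\<theta>. H (exp (- \<theta>))" "\<kappa>bar + sbar" "\<lambda>x. - ln (T x)", OF G h this x]
      show ?thesis unfolding rate_eq by simp
    qed
    have \<psi>: "\<psi> \<in> {0<..<min (\<kappa>bar + sbar) 1}"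
      using H_less[OF ne, of 0 q] H_less[OF ne, of q 1] q \<open>0 < 1 - \<psi>\<close> by (simp add: \<psi>_def H0 H1)
    then have "0 < T \<psi> \<and> T \<psi> \<le> 1 \<and> H (T \<psi>) = \<psi>" by (intro T) simp
    then have "0 < T \<psi> \<and> T \<psi> \<le> 1 \<and> H (T \<psi>) = H q" unfolding \<psi>_def .
    then have "T \<psi> = q" using H_inj[of "T \<psi>" q] q by auto
    then have d\<psi>: "(aux_rate f \<kappa> has_real_derivative ln ((1 - \<psi>) / (fbar 1 + 1 - \<psi>))) (at \<psi>)"
    proof -
      have "\<psi> \<in> {0<..<\<kappa>bar + sbar}" using \<psi> by simp
      from deriv[OF this] show ?thesis unfolding \<open>T \<psi> = q\<close> q_eq .
    qed
    have iff: "(aux_rate f \<kappa> has_real_derivative ln ((1 - x) / (fbar 1 + 1 - x))) (at x) \<longleftrightarrow>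
          (\<exists>D. (aux_Lambda f \<kappa> has_real_derivative D) (at (- ln ((1 - x) / (fbar 1 + 1 - x)))) \<and>
               x + D = 0)" if x: "x \<in> {0<..<min (\<kappa>bar + sbar) 1}" for x
    proof -
      define Q where "Q = (1 - x) / (fbar 1 + 1 - x)"
      have Q: "0 < Q" "Q < 1" unfolding Q_def using x assms(3) by (auto simp: divide_simps)
      have Tx: "0 < T x" "T x \<le> 1" "H (T x) = x" using T[of x] x by auto
      \<comment> \<open>As \<open>Q < 1\<close>, the point \<open>- ln Q\<close> is interior to the
        half-line on which \<open>aux_Lambda\<close> equals \<open>G\<close>, so the derivative
        carries over.\<close>
      have "(aux_Lambda f \<kappa> has_real_derivative - H Q) (at (- ln Q))"
      proof (rule has_field_derivative_transform_within_open)
        show "(G has_real_derivative - H Q) (at (- ln Q))" using G[of "- ln Q"] Q by simp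
        show "open {0::real<..}" by simp
      qed (use Q Lambda in auto)
      \<comment> \<open>By uniqueness of derivatives both equations amount to
        \<open>H Q = x\<close>: directly for \<open>aux_Lambda\<close>, through injectivity of
        \<open>H\<close> and of the logarithm for the rate function.\<close>
      then have "(\<exists>D. (aux_Lambda f \<kappa> has_real_derivative D) (at (- ln Q)) \<and> x + D = 0) \<longleftrightarrow> x = H Q"
        using DERIV_unique by force
      also have "\<dots> \<longleftrightarrow> T x = Q" using H_inj[of "T x" Q] Tx Q by auto
      also have "\<dots> \<longleftrightarrow> ln (T x) = ln Q" using Tx Q by simp
      also have "\<dots> \<longleftrightarrow> (aux_rate f \<kappa> has_real_derivative ln Q) (at x)"
        using deriv[of x] x DERIV_unique by force
      finally show ?thesis unfolding Q_def by blast
    qed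
    show ?thesis using \<psi> d\<psi> iff by blast
  qed
  note lim = fbar assms(3) fbar_nonneg \<kappa>bar assms(7) q(1,2) q_root
  show ?thesis
  proof (intro exI[of _ \<psi>] conjI)
    show "if \<kappa>bar + sbar = 0 then \<psi> = 0 else \<psi> \<in> {0<..<min (\<kappa>bar + sbar) 1} \<and>
       (aux_rate f \<kappa> has_real_derivative ln ((1 - \<psi>) / (fbar 1 + 1 - \<psi>))) (at \<psi>) \<and>
       (\<forall>x\<in>{0<..<min (\<kappa>bar + sbar) 1}.
          (aux_rate f \<kappa> has_real_derivative ln ((1 - x) / (fbar 1 + 1 - x))) (at x) \<longleftrightarrow>
          (\<exists>D. (aux_Lambda f \<kappa> has_real_derivative D) (at (- ln ((1 - x) / (fbar 1 + 1 - x)))) \<and>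
               x + D = 0))"
    proof (cases "\<kappa>bar + sbar = 0")
      case True
      show ?thesis unfolding if_P[OF True] \<psi>_def by (rule H_zero[OF True])
    next
      case False
      show ?thesis unfolding if_not_P[OF False] by (rule rate[OF False])
    qed
  next
    show "\<forall>i j. j \<in> {1..K} \<and> (\<forall>m\<ge>1. i m \<in> {1..f m} \<and> \<kappa> m (i m) = \<kappa>\<^sub>c m j) \<longrightarrow>
       (\<forall>l::nat. (\<lambda>m. measure_pmf.prob (stationary_pmf (\<kappa> m) m (f m)) {L. L (i m) \<ge> l})
          \<longlonglongrightarrow> (\<rho> j * ((1 - \<psi>) / (fbar 1 + 1 - \<psi>))) ^ l)"
      unfolding q_eq by (intro allI impI prob_filament_tendsto[OF lim]) auto
    show "\<forall>\<epsilon>>0. (\<lambda>m. measure_pmf.prob (stationary_pmf (\<kappa> m) m (f m))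
         {L. \<bar>free_monomers m (f m) L / real m - \<kappa>bar * ((1 - \<psi>) / (fbar 1 + 1 - \<psi>))\<bar> > \<epsilon>})
       \<longlonglongrightarrow> 0"
      unfolding q_eq by (intro allI impI free_monomers_tendsto_prob[OF lim])
  qed
qed

end
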